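(* There is a constant $c$ with $0<c\le 7$ such that the following holds. For every constant $K>0$ there is a constant $C_K$ such that every undirected unweighted graph $G=(V,E)$ with $n$ vertices and at most $Kn$ edges admits a hub labeling $\{S_v\}$ with $$\frac{1}{n}\sum_{v\in V}|S_v|\le C_K\cdot\frac{n}{\mathsf{RS}(n)^{1/c}}.$$
   Context: A hub labeling of an undirected graph $G=(V,E)$ is a family of sets $S_v\subseteq V$, $v\in V$, such that for every pair $u,v\in V$ at finite distance there is $w\in S_u\cap S_v$ with $\mathrm{dist}(u,w)+\mathrm{dist}(w,v)=\mathrm{dist}(u,v)$. A matching $M\subseteq E(G)$ is an induced matching if there is $V'\subseteq V(G)$ such that $M$ is exactly the edge set of the subgraph of $G$ induced by $V'$. A Ruzsa–Szemerédi graph is an undirected unweighted graph on $n$ vertices whose edge set can be partitioned into at most $n$ induced matchings. $\mathsf{RS}(n)$ is the largest value such that every Ruzsa–Szemerédi graph on $n$ vertices has at most $n^2/\mathsf{RS}(n)$ edges. *)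

theory Defs
  imports Complex_Main "HOL-Library.Extended_Nat"
begin

definition simple_graph :: "nat set \<Rightarrow> nat set set \<Rightarrow> bool" where
  "simple_graph V E \<longleftrightarrow> finite V \<and>
     (\<forall>e\<in>E. \<exists>a b. a \<noteq> b \<and> a \<in> V \<and> b \<in> V \<and> e = {a, b})"

definition walk :: "nat set set \<Rightarrow> nat list \<Rightarrow> bool" where
  "walk E xs \<longleftrightarrow> xs \<noteq> [] \<and> (\<forall>i. i + 1 < length xs \<longrightarrow> {xs ! i, xs ! (i + 1)} \<in> E)"

definition gdist :: "nat set set \<Rightarrow> nat \<Rightarrow> nat \<Rightarrow> enat" where
  "gdist E u v = (INF xs \<in> {xs. walk E xs \<and> hd xs = u \<and> last xs = v}. enat (length xs - 1))"

definition hub_labeling :: "nat set \<Rightarrow> nat set set \<Rightarrow> (nat \<Rightarrow> nat set) \<Rightarrow> bool" where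
  "hub_labeling V E S \<longleftrightarrow> (\<forall>v\<in>V. S v \<subseteq> V) \<and>
     (\<forall>u\<in>V. \<forall>v\<in>V. gdist E u v \<noteq> \<infinity> \<longrightarrow>
        (\<exists>w\<in>S u \<inter> S v. gdist E u w + gdist E w v = gdist E u v))"

definition matching :: "nat set set \<Rightarrow> bool" where
  "matching M \<longleftrightarrow> (\<forall>e\<in>M. \<forall>f\<in>M. e \<noteq> f \<longrightarrow> e \<inter> f = {})"

definition induced_matching :: "nat set \<Rightarrow> nat set set \<Rightarrow> nat set set \<Rightarrow> bool" where
  "induced_matching V E M \<longleftrightarrow> M \<subseteq> E \<and> matching M \<and>
     (\<exists>V'. V' \<subseteq> V \<and> M = {e \<in> E. e \<subseteq> V'})"

text \<open>Ruzsa--Szemeredi graph on n vertices (vertex set {0..<n}): the edge set can be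
  partitioned into at most n induced matchings (some parts may be empty).\<close>
definition RS_graph :: "nat \<Rightarrow> nat set set \<Rightarrow> bool" where
  "RS_graph n E \<longleftrightarrow> simple_graph {0..<n} E \<and>
     (\<exists>M :: nat \<Rightarrow> nat set set.
        (\<forall>i<n. induced_matching {0..<n} E (M i)) \<and>
        (\<forall>i<n. \<forall>j<n. i \<noteq> j \<longrightarrow> M i \<inter> M j = {}) \<and>
        E = (\<Union>i<n. M i))"

definition RS :: "nat \<Rightarrow> real" where
  "RS n = (GREATEST r. r > 0 \<and> (\<forall>E. RS_graph n E \<longrightarrow> real (card E) \<le> (real n)^2 / r))"

end

theory Submission
  imports Defs
begin

text \<open>
  Let \<open>R = RS n\<close>. Pairs with at least \<open>D\<close> vertices on their shortest paths are, up to few exceptions, hit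
  by a small common set of hubs. For the other pairs fix canonical shortest paths and let vertices and
  edges compete as hubs: for an item \<open>p\<close> and positions \<open>a\<close>, \<open>b\<close>, take a maximal matching in the bipartite
  graph of pairs whose canonical path meets \<open>p\<close> at distance \<open>a\<close> from the left end and \<open>b\<close> from the right
  end, and give \<open>p\<close> to all matched vertices. Colour the items with \<open>q\<close> colours and discard the few pairs
  that see two equally coloured items at one position. For fixed \<open>a\<close>, \<open>b\<close> and colour the matchings are then
  induced matchings in their union, so their total size is \<open>O(n\<^sup>2 / R)\<close>. Walking along a canonical path,
  consecutive items are given to different ends at some point, and the vertex they share is a common hub.
\<close>

section \<open>Ruzsa--Szemeredi numbers and induced matchings\<close>

text \<open>Crude finiteness bound: it guarantees that a largest edge count exists, which
  \<open>RS_properties\<close> needs.\<close>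

lemma RS_graph_card_le:
  assumes "RS_graph n E"
  shows "card E \<le> 2 ^ n" "E \<subseteq> Pow {0..<n}"
proof -
  show "E \<subseteq> Pow {0..<n}"
    using assms by (force simp: RS_graph_def simple_graph_def)
  then show "card E \<le> 2 ^ n"
    using card_mono[of "Pow {0..<n}" E] by (simp add: card_Pow)
qed

lemma RS_graph_single_edge:
  assumes "n \<ge> 2"
  shows "RS_graph n {{0, 1}}"
proof -
  have "induced_matching {0..<n} {{0, 1}} (if i = 0 then {{0, 1}} else {})" for i :: nat
  proof (cases "i = 0")
    case True
    have "{0, 1} \<subseteq> {0..<n}" using assms by auto
    then show ?thesis
      using True by (auto simp: induced_matching_def matching_def intro!: exI[of _ "{0, 1}"])
  next
    case False
    then show ?thesis
      by (auto simp: induced_matching_def matching_def intro!: exI[of _ "{}"])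
  qed
  moreover have "simple_graph {0..<n} {{0, 1}}"
    unfolding simple_graph_def using assms by (intro conjI ballI exI[of _ 0] exI[of _ 1]) auto
  moreover have "{{0, 1}} = (\<Union>i<n. if i = 0 then {{0, 1}} else {})"
    using assms by (auto split: if_splits)
  ultimately show ?thesis
    unfolding RS_graph_def
    by (intro conjI exI[of _ "\<lambda>i. if i = 0 then {{0, 1}} else {}"] allI impI) (assumption | simp)+
qed

text \<open>\<open>RS n\<close> is a \<open>GREATEST\<close> over the reals, so a greatest value
  must be exhibited first: it is \<open>(real n)\<^sup>2 / m\<close> with \<open>m\<close> the
  largest edge count. The hypothesis \<open>n \<ge> 2\<close> provides a graph with one edge, hence
  \<open>m \<ge> 1\<close>; without edges every positive \<open>r\<close> would qualify.\<close>

lemma RS_properties: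
  assumes "n \<ge> 2"
  shows RS_pos: "RS n > 0"
    and RS_graph_card_le_RS: "\<And>E. RS_graph n E \<Longrightarrow> real (card E) \<le> (real n)\<^sup>2 / RS n"
    and RS_le_square: "RS n \<le> (real n)\<^sup>2"
proof -
  define A where "A = card ` {E. RS_graph n E}"
  define m where "m = Max A"
  have "A \<subseteq> {.. 2 ^ n}" using RS_graph_card_le by (auto simp: A_def)
  then have fin: "finite A" using finite_subset by blast
  have one: "1 \<in> A"
    using RS_graph_single_edge[OF assms] unfolding A_def by (force intro: image_eqI[of _ _ "{{0, 1}}"])
  have m_ge: "k \<le> m" if "k \<in> A" for k using fin that by (simp add: m_def)
  then have m1: "m \<ge> 1" using one by blast
  have "m \<in> A" using fin one by (auto simp: m_def intro: Max_in)
  then obtain F where F: "RS_graph n F" "card F = m" by (auto simp: A_def)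
  have RS_eq: "RS n = (real n)\<^sup>2 / m"
    unfolding RS_def
  proof (rule Greatest_equality, intro conjI allI impI)
    show "(real n)\<^sup>2 / real m > 0" using assms m1 by simp
  next
    fix E assume "RS_graph n E"
    then have "card E \<le> m" using m_ge by (auto simp: A_def)
    then show "real (card E) \<le> (real n)\<^sup>2 / ((real n)\<^sup>2 / real m)"
      using assms by simp
  next
    fix r assume r: "r > 0 \<and> (\<forall>E. RS_graph n E \<longrightarrow> real (card E) \<le> (real n)\<^sup>2 / r)"
    then have "real m \<le> (real n)\<^sup>2 / r" using F by auto
    then show "r \<le> (real n)\<^sup>2 / real m"
      using r m1 by (simp add: field_simps)
  qed
  show "RS n > 0" using RS_eq assms m1 by simp
  show "real (card E) \<le> (real n)\<^sup>2 / RS n" if "RS_graph n E" for E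
    using RS_eq m_ge that assms by (auto simp: A_def)
  show "RS n \<le> (real n)\<^sup>2"
    using m1 assms by (simp add: RS_eq field_simps)
qed

text \<open>Ordered pairs are read as edges of a bipartite graph whose two sides may share names.
  The last clause packs two facts into one: distinct matchings are disjoint (take both edges equal),
  and each matching is induced in the union of all of them.\<close>

definition induced_family :: "'i set \<Rightarrow> ('i \<Rightarrow> ('a \<times> 'b) set) \<Rightarrow> bool" where
  "induced_family I M \<longleftrightarrow>
     (\<forall>i\<in>I. inj_on fst (M i) \<and> inj_on snd (M i)) \<and>
     (\<forall>i\<in>I. \<forall>j\<in>I. \<forall>x y x' y'. (x, y) \<in> M i \<longrightarrow> (x', y') \<in> M i \<longrightarrow> (x, y') \<in> M j \<longrightarrow> i = j)"

lemma induced_familyI: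
  assumes "\<And>i x y y'. i \<in> I \<Longrightarrow> (x, y) \<in> M i \<Longrightarrow> (x, y') \<in> M i \<Longrightarrow> y = y'"
    and "\<And>i x x' y. i \<in> I \<Longrightarrow> (x, y) \<in> M i \<Longrightarrow> (x', y) \<in> M i \<Longrightarrow> x = x'"
    and "\<And>i j x y x' y'. i \<in> I \<Longrightarrow> j \<in> I \<Longrightarrow> (x, y) \<in> M i \<Longrightarrow> (x', y') \<in> M i \<Longrightarrow> (x, y') \<in> M j \<Longrightarrow> i = j"
  shows "induced_family I M"
proof -
  have "inj_on fst (M i) \<and> inj_on snd (M i)" if "i \<in> I" for i
    using assms(1,2)[OF that] by (auto simp: inj_on_def)
  then show ?thesis
    unfolding induced_family_def using assms(3) by blast
qed

lemma induced_familyD: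
  assumes "induced_family I M" "i \<in> I"
  shows "(x, y) \<in> M i \<Longrightarrow> (x, y') \<in> M i \<Longrightarrow> y = y'"
    and "(x, y) \<in> M i \<Longrightarrow> (x', y) \<in> M i \<Longrightarrow> x = x'"
    and "j \<in> I \<Longrightarrow> (x, y) \<in> M i \<Longrightarrow> (x', y') \<in> M i \<Longrightarrow> (x, y') \<in> M j \<Longrightarrow> i = j"
proof -
  have inj: "inj_on fst (M i)" "inj_on snd (M i)"
    using assms by (auto simp: induced_family_def)
  show "(x, y) \<in> M i \<Longrightarrow> (x, y') \<in> M i \<Longrightarrow> y = y'"
    using inj_onD[OF inj(1), of "(x, y)" "(x, y')"] by simp
  show "(x, y) \<in> M i \<Longrightarrow> (x', y) \<in> M i \<Longrightarrow> x = x'"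
    using inj_onD[OF inj(2), of "(x, y)" "(x', y)"] by simp
  show "i = j" if "j \<in> I" "(x, y) \<in> M i" "(x', y') \<in> M i" "(x, y') \<in> M j"
    using assms that unfolding induced_family_def by blast
qed

text \<open>With the sides separated at the threshold \<open>h\<close>, an unordered edge determines
  its ordered pair. The matchings thus become \<open>n\<close> disjoint induced matchings of one RS
  graph on \<open>n\<close> vertices.\<close>

lemma induced_family_card_split_vertices:
  fixes M :: "nat \<Rightarrow> (nat \<times> nat) set"
  assumes n: "n \<ge> 2" and fam: "induced_family {..<n} M"
    and sub: "\<And>i. i < n \<Longrightarrow> M i \<subseteq> {0..<h} \<times> {h..<n}"
  shows "(\<Sum>i<n. real (card (M i))) \<le> (real n)\<^sup>2 / RS n"
proof -
  define e where "e = (\<lambda>(x::nat, y::nat). {x, y})"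
  define N where "N = (\<lambda>i. e ` M i)"
  define E where "E = (\<Union>i<n. N i)"
  have lt: "x < h" "h \<le> y" "y < n" if "(x, y) \<in> M i" "i < n" for x y i
    using sub that by fastforce+
  have e_inj: "inj_on e ({0..<h} \<times> {h..<n})"
    by (auto simp: inj_on_def e_def doubleton_eq_iff)
  have disj: "M i \<inter> M j = {}" if "i < n" "j < n" "i \<noteq> j" for i j
    using induced_familyD(3)[OF fam, of i j] that by fastforce
  have Ndisj: "N i \<inter> N j = {}" if "i < n" "j < n" "i \<noteq> j" for i j
    using disj[OF that] inj_on_image_Int[OF e_inj sub sub, of i j] that by (simp add: N_def)
  have ind: "induced_matching {0..<n} E (N i)" if i: "i < n" for i
    unfolding induced_matching_def
  \<comment> \<open>The inducing vertex set consists of the vertices covered by the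
    matching.\<close>
  proof (intro conjI exI[of _ "\<Union>(N i)"])
    show "N i \<subseteq> E" using i by (auto simp: E_def)
    show "matching (N i)"
      unfolding matching_def
    proof (intro ballI impI)
      fix f g assume "f \<in> N i" "g \<in> N i" "f \<noteq> g"
      then obtain x y x' y' where *: "(x, y) \<in> M i" "f = {x, y}" "(x', y') \<in> M i" "g = {x', y'}"
        by (auto simp: N_def e_def)
      then have "x \<noteq> x'" "y \<noteq> y'"
        using induced_familyD(1,2)[OF fam, of i] i \<open>f \<noteq> g\<close> by (metis lessThan_iff)+
      then show "f \<inter> g = {}" using * lt[of x y i] lt[of x' y' i] i by auto
    qed
    show "\<Union>(N i) \<subseteq> {0..<n}"
      using lt[OF _ i] by (fastforce simp: N_def e_def)
    show "N i = {f \<in> E. f \<subseteq> \<Union>(N i)}"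
    proof (intro equalityI subsetI)
      fix f assume "f \<in> N i" then show "f \<in> {f \<in> E. f \<subseteq> \<Union>(N i)}" using i by (auto simp: E_def)
    next
      fix f assume f: "f \<in> {f \<in> E. f \<subseteq> \<Union>(N i)}"
      then obtain j x y where j: "j < n" "(x, y) \<in> M j" "f = {x, y}"
        by (auto simp: E_def N_def e_def)
      have xy: "x < h" "h \<le> y" using lt j by auto
      have "x \<in> \<Union>(N i)" "y \<in> \<Union>(N i)" using f j by auto
      \<comment> \<open>Both ends of \<open>f\<close> are covered by \<open>N i\<close>. As
        \<open>x\<close> lies below \<open>h\<close> and \<open>y\<close> does not, each occurs on
        its own side in some pair of \<open>M i\<close>.\<close>
      then obtain y' x' where "(x, y') \<in> M i" "(x', y) \<in> M i"
        using xy lt[OF _ i] by (fastforce simp: N_def e_def)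
      then have "i = j" using induced_familyD(3)[OF fam, of i j x y' x' y] i j by auto
      then show "f \<in> N i" using j by (force simp: N_def e_def)
    qed
  qed
  have sg: "simple_graph {0..<n} E"
    unfolding simple_graph_def
  proof (intro conjI ballI)
    fix f assume "f \<in> E"
    then obtain j x y where j: "j < n" "(x, y) \<in> M j" "f = {x, y}"
      by (auto simp: E_def N_def e_def)
    then show "\<exists>a b. a \<noteq> b \<and> a \<in> {0..<n} \<and> b \<in> {0..<n} \<and> f = {a, b}"
      using lt[OF j(2,1)] by (intro exI[of _ x] exI[of _ y]) auto
  qed simp
  have "RS_graph n E"
    unfolding RS_graph_def using sg ind Ndisj E_def by blast
  then have "real (card E) \<le> (real n)\<^sup>2 / RS n" using RS_graph_card_le_RS n by blast
  moreover have "card E = (\<Sum>i<n. card (N i))"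
    unfolding E_def
  proof (rule card_UN_disjoint)
    show "\<forall>i\<in>{..<n}. finite (N i)"
      using finite_subset[OF sub] by (simp add: N_def)
  qed (use Ndisj in auto)
  moreover have "card (N i) = card (M i)" if "i < n" for i
    unfolding N_def using card_image inj_on_subset[OF e_inj sub] that by blast
  ultimately show ?thesis by simp
qed

lemma sum_card_partition:
  assumes "finite J" "finite X" "\<And>x. x \<in> X \<Longrightarrow> k x \<in> J"
  shows "card X = (\<Sum>j\<in>J. card {x \<in> X. k x = j})"
proof -
  have "card X = (\<Sum>x\<in>X. 1)" by simp
  also have "\<dots> = (\<Sum>j\<in>J. \<Sum>x | x \<in> X \<and> k x = j. 1)"
    by (rule sum.group[symmetric]) (use assms in auto)
  finally show ?thesis by simp
qed

text \<open>The reduction keeps the number \<open>n\<close> of vertices, so that \<open>RS n\<close>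
  itself appears. Vertices are cut into at most three blocks and indices into \<open>G\<close>
  groups of at most \<open>n\<close>. Each of the nine ordered pairs of blocks is moved to disjoint
  sides, and \<open>induced_family_card_split_vertices\<close> is applied once per block pair and
  group.\<close>

lemma induced_family_card_le:
  fixes M :: "'i \<Rightarrow> ('a \<times> 'a) set" and V :: "'a set"
  assumes n: "card V = n" "n \<ge> 2" and I: "finite I" "card I \<le> G * n"
    and fam: "induced_family I M" and sub: "\<And>i. i \<in> I \<Longrightarrow> M i \<subseteq> V \<times> V"
  shows "(\<Sum>i\<in>I. real (card (M i))) \<le> 9 * real G * (real n)\<^sup>2 / RS n"
proof -
  \<comment> \<open>Two blocks of size \<open>h\<close> fit into \<open>n\<close> vertices, and
    three cover them since \<open>n \<le> 2 * h + 1 \<le> 3 * h\<close>.\<close>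
  define h where "h = n div 2"
  have h: "h \<ge> 1" "2 * h \<le> n" "n \<le> 2 * h + 1" using n by (auto simp: h_def)
  have "finite V" using n card.infinite by fastforce
  then obtain f where f: "bij_betw f V {0..<n}" using ex_bij_betw_finite_nat n by blast
  obtain g where g: "bij_betw g I {0..<card I}" using ex_bij_betw_finite_nat I by blast
  have finM: "finite (M i)" if "i \<in> I" for i
    using sub[OF that] \<open>finite V\<close> finite_subset by blast
  have fdiv: "f v div h < 3" if "v \<in> V" for v
  proof -
    have "f v < n" using f that by (auto simp: bij_betw_def)
    then have "f v < 3 * h" using h by linarith
    then show ?thesis by (simp add: less_mult_imp_div_less)
  qed
  have gdiv: "g i div n < G" if "i \<in> I" for i
  proof -
    have "g i < G * n" using g that I bij_betw_apply by fastforce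
    then show ?thesis by (simp add: less_mult_imp_div_less)
  qed
  \<comment> \<open>\<open>C i j\<close> is the part of \<open>M i\<close> in the block pair
    \<open>j\<close>, and \<open>pr\<close> moves it to the sides \<open>{0..<h}\<close> and
    \<open>{h..<2 * h}\<close>. The set \<open>N j k s\<close> comes from the only possible index
    with code \<open>k * n + s\<close>, and is empty if there is none.\<close>
  define C where "C = (\<lambda>i j. {(u, v) \<in> M i. (f u div h, f v div h) = j})"
  define pr where "pr = (\<lambda>(u, v). (f u mod h, h + f v mod h))"
  define N where "N = (\<lambda>j k s. pr ` (\<Union>i\<in>{i\<in>I. g i = k * n + s}. C i j))"
  have same: "u = u'" if "u \<in> V" "u' \<in> V" "f u div h = f u' div h" "f u mod h = f u' mod h" for u u'
  proof -
    have "f u = f u'" using that(3,4) by (metis div_mult_mod_eq)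
    then show ?thesis using that(1,2) f by (auto simp: bij_betw_def inj_on_def)
  qed
  have pr_inj: "inj_on pr (\<Union>i\<in>I. C i j)" for j
  proof (rule inj_onI)
    fix a b assume a: "a \<in> (\<Union>i\<in>I. C i j)" "b \<in> (\<Union>i\<in>I. C i j)" "pr a = pr b"
    obtain u v u' v' where ab: "a = (u, v)" "b = (u', v')" by (metis surj_pair)
    have "f u div h = f u' div h" "f v div h = f v' div h" "f u mod h = f u' mod h" "f v mod h = f v' mod h"
      using a by (auto simp: ab C_def pr_def)
    moreover have "u \<in> V" "v \<in> V" "u' \<in> V" "v' \<in> V" using a sub by (auto simp: C_def ab)
    ultimately show "a = b" using same ab by blast
  qed
  have N_mem: "\<exists>i\<in>I. g i = k * n + s \<and> (\<exists>a \<in> C i j. pr a = z)" if "z \<in> N j k s" for j k s z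
    using that by (auto simp: N_def)
  have g_inj: "i = i'" if "i \<in> I" "i' \<in> I" "g i = g i'" for i i'
    using g that by (auto simp: bij_betw_def inj_on_def)
  have Nfam: "induced_family {..<n} (N j k)" for j k
  proof -
    have lift: "\<exists>i\<in>I. \<exists>u v. g i = k * n + s \<and> (u, v) \<in> M i \<and> u \<in> V \<and> v \<in> V \<and>
        f u div h = fst j \<and> f v div h = snd j \<and> x = f u mod h \<and> y = h + f v mod h"
      if "(x, y) \<in> N j k s" for x y s
      using N_mem[OF that] sub by (fastforce simp: C_def pr_def)
    \<comment> \<open>Both pairs originate in the same \<open>M i\<close>, because the code
      \<open>k * n + s\<close> determines \<open>i\<close>.\<close>
    have vert: "\<exists>i\<in>I. \<exists>u v u' v'. (u, v) \<in> M i \<and> (u', v') \<in> M i \<and> g i = k * n + s \<and>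
        {u, v, u', v'} \<subseteq> V \<and>
        f u div h = fst j \<and> f v div h = snd j \<and> x = f u mod h \<and> y = h + f v mod h \<and>
        f u' div h = fst j \<and> f v' div h = snd j \<and> x' = f u' mod h \<and> y' = h + f v' mod h"
      if xy: "(x, y) \<in> N j k s" "(x', y') \<in> N j k s" for x y x' y' s
    proof -
      from lift[OF xy(1)] obtain i u v where 1: "i \<in> I" "g i = k * n + s" "(u, v) \<in> M i" "u \<in> V" "v \<in> V"
        "f u div h = fst j" "f v div h = snd j" "x = f u mod h" "y = h + f v mod h" by blast
      from lift[OF xy(2)] obtain i' u' v' where 2: "i' \<in> I" "g i' = k * n + s" "(u', v') \<in> M i'"
        "u' \<in> V" "v' \<in> V"
        "f u' div h = fst j" "f v' div h = snd j" "x' = f u' mod h" "y' = h + f v' mod h" by blast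
      have "i' = i" using g_inj 1 2 by simp
      then show ?thesis using 1 2 by (intro bexI[of _ i] exI[of _ u] exI[of _ v] exI[of _ u'] exI[of _ v']) auto
    qed
    show ?thesis
    proof (rule induced_familyI)
      fix s x y y' assume "(x, y) \<in> N j k s" "(x, y') \<in> N j k s"
      from vert[OF this] obtain i u v u' v' where *: "i \<in> I" "(u, v) \<in> M i" "(u', v') \<in> M i"
        "u \<in> V" "u' \<in> V" "f u div h = f u' div h" "f u mod h = f u' mod h"
        "y = h + f v mod h" "y' = h + f v' mod h" by auto
      then have "u = u'" using same by blast
      then show "y = y'" using * induced_familyD(1)[OF fam] by blast
    next
      fix s x y x' assume "(x, y) \<in> N j k s" "(x', y) \<in> N j k s"
      from vert[OF this] obtain i u v u' v' where *: "i \<in> I" "(u, v) \<in> M i" "(u', v') \<in> M i"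
        "v \<in> V" "v' \<in> V" "f v div h = f v' div h" "f v mod h = f v' mod h"
        "x = f u mod h" "x' = f u' mod h" by auto
      then have "v = v'" using same by blast
      then show "x = x'" using * induced_familyD(2)[OF fam] by blast
    next
      fix s s' x y x' y' assume a: "(x, y) \<in> N j k s" "(x', y') \<in> N j k s" "(x, y') \<in> N j k s'"
      from vert[OF a(1,2)] obtain i u v u' v' where 1: "i \<in> I" "g i = k * n + s"
        "(u, v) \<in> M i" "(u', v') \<in> M i" "u \<in> V" "v' \<in> V" "f u div h = fst j" "f v' div h = snd j"
        "x = f u mod h" "y' = h + f v' mod h" by blast
      from lift[OF a(3)] obtain i2 u2 v2 where 2: "i2 \<in> I" "g i2 = k * n + s'" "(u2, v2) \<in> M i2"
        "u2 \<in> V" "v2 \<in> V" "f u2 div h = fst j" "f v2 div h = snd j" "x = f u2 mod h" "y' = h + f v2 mod h"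
        by blast
      have "u2 = u" using 1 2 by (intro same) auto
      moreover have "v2 = v'" using 1 2 by (intro same) auto
      ultimately have "i = i2" using induced_familyD(3)[OF fam] 1 2 by blast
      then show "s = s'" using 1 2 by simp
    qed
  qed
  have Nsub: "N j k s \<subseteq> {0..<h} \<times> {h..<n}" for j k s
  proof -
    have "a mod h < h" "h + a mod h < n" for a
    proof -
      show "a mod h < h" using h by simp
      then show "h + a mod h < n" using h by linarith
    qed
    then show ?thesis by (auto simp: N_def pr_def)
  qed
  have Nsum: "(\<Sum>s<n. card (N j k s)) = (\<Sum>i | i \<in> I \<and> g i div n = k. card (C i j))" for j k
  proof -
    have fC: "finite (C i j)" if "i \<in> I" for i
      using finM[OF that] by (auto simp: C_def intro: finite_subset[of _ "M i"])
    have "(\<Sum>i | i \<in> I \<and> g i div n = k. card (C i j))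
        = (\<Sum>s<n. \<Sum>i | i \<in> {i \<in> I. g i div n = k} \<and> g i mod n = s. card (C i j))"
      by (rule sum.group[symmetric]) (use I n in auto)
    also have "\<dots> = (\<Sum>s<n. card (N j k s))"
    proof (rule sum.cong[OF refl])
      fix s assume "s \<in> {..<n}"
      then have eq: "{i. i \<in> {i \<in> I. g i div n = k} \<and> g i mod n = s} = {i \<in> I. g i = k * n + s}"
        using n by auto
      have "card (N j k s) = card (\<Union>i\<in>{i\<in>I. g i = k * n + s}. C i j)"
        unfolding N_def by (rule card_image, rule inj_on_subset[OF pr_inj]) auto
      also have "\<dots> = (\<Sum>i\<in>{i\<in>I. g i = k * n + s}. card (C i j))"
        by (rule card_UN_disjoint) (use I fC g_inj in \<open>auto\<close>)
      finally show "(\<Sum>i | i \<in> {i \<in> I. g i div n = k} \<and> g i mod n = s. card (C i j)) = card (N j k s)"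
        using eq by simp
    qed
    finally show ?thesis by simp
  qed
  define J where "J = {..<3::nat} \<times> {..<3::nat}"
  have "(\<Sum>i\<in>I. card (M i)) = (\<Sum>i\<in>I. \<Sum>j\<in>J. card (C i j))"
  proof (rule sum.cong[OF refl])
    fix i assume i: "i \<in> I"
    have "card (M i) = (\<Sum>j\<in>J. card {x \<in> M i. (case x of (u, v) \<Rightarrow> (f u div h, f v div h)) = j})"
      by (rule sum_card_partition) (use finM[OF i] sub[OF i] fdiv in \<open>auto simp: J_def\<close>)
    also have "\<dots> = (\<Sum>j\<in>J. card (C i j))"
      by (intro sum.cong refl arg_cong[where f = card]) (auto simp: C_def)
    finally show "card (M i) = (\<Sum>j\<in>J. card (C i j))" .
  qed
  also have "\<dots> = (\<Sum>j\<in>J. \<Sum>i\<in>I. card (C i j))" by (rule sum.swap)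
  also have "\<dots> = (\<Sum>j\<in>J. \<Sum>k<G. \<Sum>i | i \<in> I \<and> g i div n = k. card (C i j))"
    by (intro sum.cong refl sum.group[symmetric]) (use I gdiv in auto)
  also have "\<dots> = (\<Sum>j\<in>J. \<Sum>k<G. \<Sum>s<n. card (N j k s))" by (simp add: Nsum)
  finally have "(\<Sum>i\<in>I. real (card (M i))) = (\<Sum>j\<in>J. \<Sum>k<G. \<Sum>s<n. real (card (N j k s)))"
    by (simp flip: of_nat_sum)
  also have "\<dots> \<le> (\<Sum>j\<in>J. \<Sum>k<G. (real n)\<^sup>2 / RS n)"
    by (intro sum_mono induced_family_card_split_vertices[of n _ h] n Nfam Nsub)
  also have "\<dots> = 9 * real G * (real n)\<^sup>2 / RS n" by (simp add: J_def)
  finally show ?thesis .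
qed

section \<open>Shortest paths\<close>

lemma gdist_le_walk:
  assumes "walk E xs" "hd xs = u" "last xs = v"
  shows "gdist E u v \<le> enat (length xs - 1)"
  unfolding gdist_def using assms INF_lower[of xs "{xs. walk E xs \<and> hd xs = u \<and> last xs = v}" "\<lambda>xs. enat (length xs - 1)"]
  by simp

text \<open>The infimum of a nonempty set of extended naturals is attained; an empty set would give
  \<infinity>.\<close>

lemma gdist_walk:
  assumes "gdist E u v = enat L"
  obtains xs where "walk E xs" "hd xs = u" "last xs = v" "length xs = Suc L"
proof -
  let ?W = "{xs. walk E xs \<and> hd xs = u \<and> last xs = v}"
  have ne: "?W \<noteq> {}"
  proof
    assume "?W = {}"
    then have "gdist E u v = \<infinity>" unfolding gdist_def by (simp only: image_empty Inf_enat_def) simp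
    then show False using assms by simp
  qed
  then have "Inf ((\<lambda>xs. enat (length xs - 1)) ` ?W) \<in> (\<lambda>xs. enat (length xs - 1)) ` ?W"
    unfolding Inf_enat_def by (auto intro: LeastI)
  then obtain xs where "xs \<in> ?W" "enat L = enat (length xs - 1)"
    using assms unfolding gdist_def by auto
  then show ?thesis by (intro that[of xs]) (auto simp: walk_def)
qed

lemma gdist_refl [simp]: "gdist E u u = 0"
  using gdist_le_walk[of E "[u]" u u] by (simp add: walk_def flip: zero_enat_def)

text \<open>\<open>tl\<close> drops the shared vertex so that it is not repeated; the only delicate
  index is the junction.\<close>

lemma walk_append:
  assumes "walk E xs" "walk E ys" "last xs = hd ys"
  shows "walk E (xs @ tl ys)"
proof (cases "tl ys")
  case Nil
  then show ?thesis using assms by simp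
next
  case (Cons z zs)
  then obtain y where ys: "ys = y # z # zs" using assms by (cases ys) (auto simp: walk_def)
  have ne: "xs \<noteq> []" using assms by (simp add: walk_def)
  have "{(xs @ tl ys) ! i, (xs @ tl ys) ! (i + 1)} \<in> E" if i: "i + 1 < length (xs @ tl ys)" for i
  proof -
    consider "i + 1 < length xs" | "i + 1 = length xs" | "i \<ge> length xs" by linarith
    then show ?thesis
    proof cases
      case 1
      then show ?thesis using assms by (simp add: walk_def nth_append)
    next
      case 2
      then have "xs ! i = y" using assms ne ys by (simp add: last_conv_nth flip: 2)
      moreover have "{y, z} \<in> E" using assms(2) by (auto simp: walk_def ys dest: spec[of _ 0])
      ultimately show ?thesis using 2 by (simp add: nth_append ys)
    next
      case 3
      define j where "j = i - length xs"
      have "{ys ! (j + 1), ys ! (j + 1 + 1)} \<in> E"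
      proof -
        have "j + 1 + 1 < length ys" using i 3 by (simp add: ys j_def)
        then show ?thesis using assms(2) unfolding walk_def by blast
      qed
      then show ?thesis using 3 by (simp add: nth_append ys j_def Suc_diff_le)
    qed
  qed
  then show ?thesis using ne by (simp add: walk_def)
qed

lemma gdist_triangle: "gdist E u w \<le> gdist E u v + gdist E v w"
proof (cases "gdist E u v = \<infinity> \<or> gdist E v w = \<infinity>")
  case False
  then obtain a b where ab: "gdist E u v = enat a" "gdist E v w = enat b" by auto
  obtain xs where xs: "walk E xs" "hd xs = u" "last xs = v" "length xs = Suc a" using gdist_walk ab by metis
  obtain ys where ys: "walk E ys" "hd ys = v" "last ys = w" "length ys = Suc b" using gdist_walk ab by metis
  have ne: "xs \<noteq> []" "ys \<noteq> []" using xs ys by auto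
  have "last (xs @ tl ys) = w" using ys xs ne by (cases ys) (auto simp: last_append)
  then have "gdist E u w \<le> enat (length (xs @ tl ys) - 1)"
    using gdist_le_walk[OF walk_append[OF xs(1) ys(1)]] xs ys ne by simp
  then show ?thesis using ab xs ys by simp
qed auto

lemma gdist_path_le:
  assumes "\<And>k. i \<le> k \<Longrightarrow> k < j \<Longrightarrow> {p k, p (Suc k)} \<in> E" "i \<le> j"
  shows "gdist E (p i) (p j) \<le> enat (j - i)"
proof -
  have "walk E (map p [i..<Suc j])" using assms by (auto simp: walk_def simp del: upt_Suc)
  moreover have "hd (map p [i..<Suc j]) = p i" "last (map p [i..<Suc j]) = p j"
    using assms(2) by (simp_all add: hd_map del: upt_Suc) (simp add: last_map)
  ultimately show ?thesis
    using gdist_le_walk[of E "map p [i..<Suc j]"] assms(2) by (simp add: Suc_diff_le)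
qed

text \<open>Prefix and suffix of a minimal walk bound the two distances from above, and the triangle
  inequality leaves no slack, so both bounds are equalities.\<close>

lemma shortest_path:
  assumes "gdist E u v = enat L"
  obtains p where "p 0 = u" "p L = v" "\<And>i. i < L \<Longrightarrow> {p i, p (Suc i)} \<in> E"
    "\<And>i. i \<le> L \<Longrightarrow> gdist E u (p i) = enat i" "\<And>i. i \<le> L \<Longrightarrow> gdist E (p i) v = enat (L - i)"
proof -
  obtain xs where xs: "walk E xs" "hd xs = u" "last xs = v" "length xs = Suc L"
    using gdist_walk assms by metis
  have "xs \<noteq> []" using xs by auto
  then have ends: "xs ! 0 = u" "xs ! L = v" using xs by (auto simp: hd_conv_nth last_conv_nth)
  have edge: "{xs ! i, xs ! Suc i} \<in> E" if "i < L" for i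
    using xs that by (simp add: walk_def)
  have "gdist E u (xs ! i) = enat i \<and> gdist E (xs ! i) v = enat (L - i)" if "i \<le> L" for i
  proof -
    have le: "gdist E u (xs ! i) \<le> enat i" "gdist E (xs ! i) v \<le> enat (L - i)"
      using gdist_path_le[of 0 i "(!) xs" E] gdist_path_le[of i L "(!) xs" E] edge ends that by auto
    then obtain a b where ab: "gdist E u (xs ! i) = enat a" "gdist E (xs ! i) v = enat b"
      by (metis enat_ile)
    have "L \<le> a + b" using gdist_triangle[of E u v "xs ! i"] assms ab by simp
    moreover have "a \<le> i" "b \<le> L - i" using le ab by simp_all
    ultimately have "a = i" "b = L - i" using that by linarith+
    then show ?thesis using ab by simp
  qed
  then show ?thesis using that[of "(!) xs"] ends edge by blast
qed

section \<open>Greedy colourings, hitting sets and matchings\<close>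

(* Method of conditional expectations: colour the items one at a time. *)
lemma ex_colouring_few_monochromatic:
  fixes f g :: "'t \<Rightarrow> 'i"
  assumes "finite P" "finite T" "q > 0" and neq: "\<And>t. t \<in> T \<Longrightarrow> f t \<noteq> g t"
  shows "\<exists>c. (\<forall>x. c x < q) \<and>
    q * card {t \<in> T. f t \<in> P \<and> g t \<in> P \<and> c (f t) = c (g t)} \<le> card {t \<in> T. f t \<in> P \<and> g t \<in> P}"
  using assms(1)
proof (induction P rule: finite_induct)
  case empty
  then show ?case using \<open>q > 0\<close> by (auto intro!: exI[of _ "\<lambda>_. 0::nat"])
next
  case (insert x P)
  then obtain c where c: "\<And>x. c x < q"
    "q * card {t \<in> T. f t \<in> P \<and> g t \<in> P \<and> c (f t) = c (g t)} \<le> card {t \<in> T. f t \<in> P \<and> g t \<in> P}"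
    by blast
  \<comment> \<open>For a pair that involves the new item \<open>x\<close>, this is the partner of
    \<open>x\<close>.\<close>
  define other where "other t = (if f t = x then g t else f t)" for t
  define X where "X = {t \<in> T. (f t = x \<or> g t = x) \<and> other t \<in> P}"
  have finX: "finite X" using \<open>finite T\<close> by (simp add: X_def)
  define m where "m k = card {t \<in> X. c (other t) = k}" for k
  have "card X = (\<Sum>t\<in>X. 1)" by simp
  also have "\<dots> = (\<Sum>k<q. \<Sum>t | t \<in> X \<and> c (other t) = k. 1)"
    by (rule sum.group[symmetric]) (use finX c in auto)
  finally have sum_m: "card X = (\<Sum>k<q. m k)" by (simp add: m_def)
  \<comment> \<open>The least frequent colour among the already coloured partners is seen by at most
    a fraction \<open>1 / q\<close> of the new pairs.\<close>
  define k where "k = arg_min_on m {..<q}"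
  have k: "k < q" "\<And>l. l < q \<Longrightarrow> m k \<le> m l"
    using arg_min_if_finite(1)[of "{..<q}" m] arg_min_least[of "{..<q}" _ m] \<open>q > 0\<close> by (auto simp: k_def)
  have "q * m k \<le> (\<Sum>k<q. m k)" using sum_mono[of "{..<q}" "\<lambda>_. m k" m] k by simp
  then have mk: "q * m k \<le> card X" using sum_m by simp
  define c' where "c' = c(x := k)"
  let ?Q = "{t \<in> T. f t \<in> P \<and> g t \<in> P}"
  have dec: "{t \<in> T. f t \<in> insert x P \<and> g t \<in> insert x P} = ?Q \<union> X"
  proof -
    have "f t \<in> insert x P \<and> g t \<in> insert x P \<longleftrightarrow> f t \<in> P \<and> g t \<in> P \<or> (f t = x \<or> g t = x) \<and> other t \<in> P"
      if "t \<in> T" for t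
      using neq[OF that] insert.hyps by (cases "f t = x") (auto simp: other_def)
    then show ?thesis by (auto simp: X_def)
  qed
  have disj: "?Q \<inter> X = {}" using insert.hyps by (auto simp: X_def)
  have "{t \<in> T. f t \<in> insert x P \<and> g t \<in> insert x P \<and> c' (f t) = c' (g t)}
      \<subseteq> {t \<in> T. f t \<in> P \<and> g t \<in> P \<and> c (f t) = c (g t)} \<union> {t \<in> X. c (other t) = k}"
  proof
    fix t assume "t \<in> {t \<in> T. f t \<in> insert x P \<and> g t \<in> insert x P \<and> c' (f t) = c' (g t)}"
    moreover from this have "f t \<noteq> g t" using neq by blast
    ultimately show "t \<in> {t \<in> T. f t \<in> P \<and> g t \<in> P \<and> c (f t) = c (g t)} \<union> {t \<in> X. c (other t) = k}"
      by (cases "f t = x"; cases "g t = x") (auto simp: X_def other_def c'_def)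
  qed
  then have "card {t \<in> T. f t \<in> insert x P \<and> g t \<in> insert x P \<and> c' (f t) = c' (g t)}
      \<le> card ({t \<in> T. f t \<in> P \<and> g t \<in> P \<and> c (f t) = c (g t)} \<union> {t \<in> X. c (other t) = k})"
    using finX \<open>finite T\<close> by (intro card_mono) auto
  also have "\<dots> \<le> card {t \<in> T. f t \<in> P \<and> g t \<in> P \<and> c (f t) = c (g t)} + m k"
    unfolding m_def by (rule card_Un_le)
  finally have "q * card {t \<in> T. f t \<in> insert x P \<and> g t \<in> insert x P \<and> c' (f t) = c' (g t)}
      \<le> q * card {t \<in> T. f t \<in> P \<and> g t \<in> P \<and> c (f t) = c (g t)} + q * m k"
    by (simp flip: add_mult_distrib2)
  also have "\<dots> \<le> card ?Q + card X" using c mk by linarith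
  also have "\<dots> = card {t \<in> T. f t \<in> insert x P \<and> g t \<in> insert x P}"
    unfolding dec using \<open>finite T\<close> finX disj by (intro card_Un_disjoint[symmetric]) auto
  finally show ?case using c k by (intro exI[of _ c']) (auto simp: c'_def)
qed

text \<open>Averaging: the sets \<open>H r\<close> have at least \<open>D * card Q\<close>
  incidences in total, shared among \<open>card V\<close> elements.\<close>

lemma ex_common_element:
  assumes "finite V" "finite Q" "\<And>r. r \<in> Q \<Longrightarrow> H r \<subseteq> V \<and> D \<le> card (H r)" "V \<noteq> {}"
  shows "\<exists>w\<in>V. D * card Q \<le> card V * card {r \<in> Q. w \<in> H r}"
proof (rule ccontr)
  assume "\<not> ?thesis"
  then have "(\<Sum>w\<in>V. card V * card {r \<in> Q. w \<in> H r}) < (\<Sum>w\<in>V. D * card Q)"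
    using assms by (intro sum_strict_mono) (auto simp: not_le)
  also have "\<dots> \<le> card V * (\<Sum>r\<in>Q. card (H r))"
    using sum_mono[of Q "\<lambda>_. D" "\<lambda>r. card (H r)"] assms(3) by (simp add: mult.commute)
  also have "(\<Sum>r\<in>Q. card (H r)) = (\<Sum>r\<in>Q. card {w \<in> V. w \<in> H r})"
    using assms(3) by (intro sum.cong refl arg_cong[where f = card]) auto
  also have "\<dots> = (\<Sum>w\<in>V. card {r \<in> Q. w \<in> H r})"
    using sum_multicount_gen[of Q V "\<lambda>r w. w \<in> H r" "\<lambda>w. card {r \<in> Q. w \<in> H r}"] assms by simp
  finally show False by (simp add: sum_distrib_left)
qed

text \<open>Greedy choice: by \<open>ex_common_element\<close> each new element hits at least a
  fraction \<open>D / card V\<close> of the sets still missed, and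
  \<open>1 - x \<le> exp (- x)\<close> turns \<open>t\<close> rounds into the exponential
  factor.\<close>

lemma ex_hitting_set:
  assumes V: "finite V" "V \<noteq> {}" and Q: "finite Q" "\<And>r. r \<in> Q \<Longrightarrow> H r \<subseteq> V \<and> D \<le> card (H r)"
  shows "\<exists>S\<subseteq>V. card S \<le> t \<and>
    real (card {r \<in> Q. H r \<inter> S = {}}) \<le> real (card Q) * exp (- (real D * real t / real (card V)))"
proof (induction t)
  case 0
  show ?case by (intro exI[of _ "{}"]) auto
next
  case (Suc t)
  then obtain S where S: "S \<subseteq> V" "card S \<le> t"
    "real (card {r \<in> Q. H r \<inter> S = {}}) \<le> real (card Q) * exp (- (real D * real t / real (card V)))" by blast
  have n: "card V > 0" using V by auto
  show ?case
  proof (cases "D \<le> card V")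
    case False
    have "D \<le> card V" if "r \<in> Q" for r
      using Q(2)[OF that] card_mono[OF V(1), of "H r"] by linarith
    then have "Q = {}" using False by blast
    then show ?thesis by (intro exI[of _ "{}"]) auto
  next
    case True
    let ?Q = "{r \<in> Q. H r \<inter> S = {}}"
    obtain w where w: "w \<in> V" "D * card ?Q \<le> card V * card {r \<in> ?Q. w \<in> H r}"
      using ex_common_element[of V ?Q H D] V Q by auto
    have eq: "{r \<in> Q. H r \<inter> insert w S = {}} = ?Q - {r \<in> ?Q. w \<in> H r}" by auto
    have le: "real D * real (card ?Q) \<le> real (card V) * real (card {r \<in> ?Q. w \<in> H r})"
      using w(2) by (simp flip: of_nat_mult)
    have "real (card {r \<in> Q. H r \<inter> insert w S = {}}) = real (card ?Q) - real (card {r \<in> ?Q. w \<in> H r})"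
      unfolding eq using Q(1) by (subst card_Diff_subset) (auto intro!: of_nat_diff card_mono)
    also have "real (card ?Q) - real (card {r \<in> ?Q. w \<in> H r}) \<le> real (card ?Q) * (1 - real D / real (card V))"
      using n le by (simp add: field_simps)
    also have "\<dots> \<le> real (card ?Q) * exp (- (real D / real (card V)))"
      using exp_ge_add_one_self[of "- (real D / real (card V))"] by (intro mult_left_mono) auto
    also have "\<dots> \<le> real (card Q) * exp (- (real D * real t / real (card V))) * exp (- (real D / real (card V)))"
      using S(3) by (intro mult_right_mono) auto
    also have "\<dots> = real (card Q) * exp (- (real D * real (Suc t) / real (card V)))"
      by (simp add: mult.assoc distrib_left add_divide_distrib add_ac flip: exp_add)
    finally have "real (card {r \<in> Q. H r \<inter> insert w S = {}}) \<le> \<dots>" .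
    moreover have "card (insert w S) \<le> Suc t"
      using S(2) card_insert_le_m1[of "Suc t" S w] by simp
    ultimately show ?thesis using S(1) w(1) by (intro exI[of _ "insert w S"]) auto
  qed
qed

text \<open>Greedy: a pair joins the matching when both its ends are still free, so a rejected pair
  is already covered.\<close>

lemma ex_maximal_matching:
  fixes R :: "('a \<times> 'b) set"
  assumes "finite R"
  shows "\<exists>M\<subseteq>R. inj_on fst M \<and> inj_on snd M \<and> (\<forall>(u, v)\<in>R. u \<in> fst ` M \<or> v \<in> snd ` M)"
  using assms
proof (induction R rule: finite_induct)
  case (insert r R)
  then obtain M where M: "M \<subseteq> R" "inj_on fst M" "inj_on snd M"
    "\<forall>(u, v)\<in>R. u \<in> fst ` M \<or> v \<in> snd ` M" by blast
  obtain a b where r: "r = (a, b)" by fastforce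
  show ?case
  proof (cases "a \<in> fst ` M \<or> b \<in> snd ` M")
    case True
    then have "\<forall>(u, v)\<in>insert r R. u \<in> fst ` M \<or> v \<in> snd ` M" using M(4) by (simp add: r)
    then show ?thesis using M(1-3) by (intro exI[of _ M]) auto
  next
    case False
    then have "inj_on fst (insert r M)" "inj_on snd (insert r M)"
      using M(2,3) by (auto simp: inj_on_insert r)
    moreover have "\<forall>(u, v)\<in>insert r R. u \<in> fst ` insert r M \<or> v \<in> snd ` insert r M"
      using M(4) by (auto simp: r)
    ultimately show ?thesis using M(1) by (intro exI[of _ "insert r M"]) auto
  qed
qed simp

section \<open>Hub labelings\<close>

locale finite_simple_graph =
  fixes V :: "nat set" and E :: "nat set set"
  assumes simple: "simple_graph V E"
begin

section \<open>Canonical shortest paths, items and colour conflicts\<close>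

definition dist_pairs :: "(nat \<times> nat) set" where
  "dist_pairs = {(u, v) \<in> V \<times> V. gdist E u v \<noteq> \<infinity>}"

definition len :: "nat \<Rightarrow> nat \<Rightarrow> nat" where
  "len u v = the_enat (gdist E u v)"

text \<open>One shortest path is fixed for each ordered pair; the two directions are chosen
  independently. The description is satisfiable for pairs in \<open>dist_pairs\<close>, where
  \<open>len\<close> is the distance.\<close>

definition spath :: "nat \<Rightarrow> nat \<Rightarrow> nat \<Rightarrow> nat" where
  "spath u v = (SOME p. p 0 = u \<and> p (len u v) = v \<and>
     (\<forall>i<len u v. {p i, p (Suc i)} \<in> E) \<and>
     (\<forall>i\<le>len u v. gdist E u (p i) = enat i \<and> gdist E (p i) v = enat (len u v - i)))"

definition between :: "nat \<times> nat \<Rightarrow> nat set" where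
  "between = (\<lambda>(u, v). {w \<in> V. gdist E u w + gdist E w v = gdist E u v})"

(* Vertices h, encoded as (h, h), and oriented edges. Using edges as hubs as well makes
   a reduction to bounded degree unnecessary. *)
definition items :: "(nat \<times> nat) set" where
  "items = {(h, h) | h. h \<in> V} \<union> {(a, b). {a, b} \<in> E}"

definition ilen :: "nat \<times> nat \<Rightarrow> nat" where
  "ilen p = (if fst p = snd p then 0 else 1)"

text \<open>At finite distance these are the items on any shortest path from \<open>u\<close> to
  \<open>v\<close>, in that direction, not only those on \<open>spath u v\<close>. They are the
  possible competitors of the canonical items.\<close>

definition items_between :: "nat \<Rightarrow> nat \<Rightarrow> (nat \<times> nat) set" where
  "items_between u v = {p \<in> items. gdist E u (fst p) + enat (ilen p) + gdist E (snd p) v = gdist E u v}"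

text \<open>For \<open>p\<close> in \<open>items_between u v\<close>, this is the item of the same
  kind (vertex or edge) that the canonical path has at the same distance from
  \<open>u\<close>.\<close>

definition mate :: "nat \<Rightarrow> nat \<Rightarrow> nat \<times> nat \<Rightarrow> nat \<times> nat" where
  "mate u v p = (spath u v (len u (fst p)), spath u v (len u (fst p) + ilen p))"

definition small_pairs :: "nat \<Rightarrow> (nat \<times> nat) set" where
  "small_pairs D = {r \<in> dist_pairs. card (between r) < D}"

text \<open>The condition is tailored to \<open>induced_family_maxmat\<close>: equally coloured
  items of one kind at the same position between \<open>u\<close> and \<open>v\<close> must coincide
  as soon as one of them is canonical.\<close>

definition good_pairs :: "nat \<Rightarrow> (nat \<times> nat \<Rightarrow> nat) \<Rightarrow> (nat \<times> nat) set" where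
  "good_pairs D c = {(u, v) \<in> small_pairs D. \<forall>p\<in>items_between u v. p \<noteq> mate u v p \<longrightarrow> c p \<noteq> c (mate u v p)}"

definition through :: "(nat \<times> nat) set \<Rightarrow> nat \<times> nat \<Rightarrow> nat \<Rightarrow> nat \<Rightarrow> (nat \<times> nat) set" where
  "through Q p a b = {(u, v) \<in> Q. len u v = a + ilen p + b \<and> fst p = spath u v a \<and> snd p = spath u v (a + ilen p)}"

definition maxmat :: "('a \<times> 'b) set \<Rightarrow> ('a \<times> 'b) set" where
  "maxmat R = (SOME M. M \<subseteq> R \<and> inj_on fst M \<and> inj_on snd M \<and> (\<forall>(u, v)\<in>R. u \<in> fst ` M \<or> v \<in> snd ` M))"

lemma finite_V: "finite V" using simple by (simp add: simple_graph_def)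

lemma edge_V:
  assumes "{a, b} \<in> E"
  shows "a \<in> V \<and> b \<in> V \<and> a \<noteq> b"
proof -
  obtain x y where "x \<noteq> y" "x \<in> V" "y \<in> V" "{a, b} = {x, y}"
    using simple assms unfolding simple_graph_def by blast
  then show ?thesis by (auto simp: doubleton_eq_iff)
qed

lemma finite_dist_pairs: "finite dist_pairs"
  by (rule finite_subset[of _ "V \<times> V"]) (use finite_V in \<open>auto simp: dist_pairs_def\<close>)

lemma card_dist_pairs: "card dist_pairs \<le> (card V)\<^sup>2"
  using card_mono[of "V \<times> V" dist_pairs] finite_V
  by (auto simp: dist_pairs_def card_cartesian_product power2_eq_square)

lemma small_subset: "small_pairs D \<subseteq> dist_pairs" by (auto simp: small_pairs_def)

lemma good_subset: "good_pairs D c \<subseteq> small_pairs D" by (auto simp: good_pairs_def)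

lemma gdist_len: "(u, v) \<in> dist_pairs \<Longrightarrow> gdist E u v = enat (len u v)"
  by (auto simp: dist_pairs_def len_def)

lemma spath:
  assumes "(u, v) \<in> dist_pairs"
  shows spath_0: "spath u v 0 = u" and spath_len: "spath u v (len u v) = v"
    and spath_edge: "i < len u v \<Longrightarrow> {spath u v i, spath u v (Suc i)} \<in> E"
    and gdist_spath_left: "i \<le> len u v \<Longrightarrow> gdist E u (spath u v i) = enat i"
    and gdist_spath_right: "i \<le> len u v \<Longrightarrow> gdist E (spath u v i) v = enat (len u v - i)"
proof -
  have "\<exists>p. p 0 = u \<and> p (len u v) = v \<and>
     (\<forall>i<len u v. {p i, p (Suc i)} \<in> E) \<and>
     (\<forall>i\<le>len u v. gdist E u (p i) = enat i \<and> gdist E (p i) v = enat (len u v - i))"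
    by (rule shortest_path[OF gdist_len[OF assms]]) blast
  then have *: "spath u v 0 = u \<and> spath u v (len u v) = v \<and>
     (\<forall>i<len u v. {spath u v i, spath u v (Suc i)} \<in> E) \<and>
     (\<forall>i\<le>len u v. gdist E u (spath u v i) = enat i \<and> gdist E (spath u v i) v = enat (len u v - i))"
    unfolding spath_def by (rule someI_ex)
  show "spath u v 0 = u" "spath u v (len u v) = v" using * by auto
  show "i < len u v \<Longrightarrow> {spath u v i, spath u v (Suc i)} \<in> E" using * by blast
  show "i \<le> len u v \<Longrightarrow> gdist E u (spath u v i) = enat i" using * by blast
  show "i \<le> len u v \<Longrightarrow> gdist E (spath u v i) v = enat (len u v - i)" using * by blast
qed

lemma spath_V:
  assumes "(u, v) \<in> dist_pairs" "i \<le> len u v"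
  shows "spath u v i \<in> V"
proof (cases "i = len u v")
  case True
  then show ?thesis using spath_len[OF assms(1)] assms(1) by (simp add: dist_pairs_def)
next
  case False
  then show ?thesis using spath_edge[OF assms(1), of i] assms(2) edge_V by (metis le_neq_implies_less)
qed

lemma spath_between:
  assumes "(u, v) \<in> dist_pairs" "i \<le> len u v"
  shows "spath u v i \<in> between (u, v)"
  using assms by (simp add: between_def spath_V gdist_spath_left gdist_spath_right gdist_len)

lemma finite_between: "finite (between r)"
  using finite_V by (auto simp: between_def split: prod.splits)

lemma between_subset: "between r \<subseteq> V"
  by (auto simp: between_def split: prod.splits)

text \<open>Vertices of the canonical path have distinct distances from \<open>u\<close>, and all of
  them lie in \<open>between (u, v)\<close>. Hence only positions below \<open>D\<close> occur for
  small pairs.\<close>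

lemma len_small:
  assumes "(u, v) \<in> small_pairs D"
  shows "len u v < D"
proof -
  have r: "(u, v) \<in> dist_pairs" using assms small_subset by blast
  have "inj_on (spath u v) {..len u v}"
    by (rule inj_onI) (metis gdist_spath_left[OF r] atMost_iff enat.inject)
  then have "Suc (len u v) = card (spath u v ` {..len u v})" by (simp add: card_image)
  also have "\<dots> \<le> card (between (u, v))"
    using spath_between[OF r] by (intro card_mono finite_between) auto
  finally show ?thesis using assms by (simp add: small_pairs_def)
qed

lemma items_V: "items \<subseteq> V \<times> V"
  using edge_V by (auto simp: items_def)

lemma finite_items: "finite items"
  using items_V finite_V finite_subset by blast

text \<open>The summand \<open>1\<close> counts the vertices, and \<open>2 * k\<close> the two
  orientations of each edge.\<close>

lemma card_items: 
  assumes "card E \<le> k * card V"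
  shows "card items \<le> (1 + 2 * k) * card V"
proof -
  have "E \<subseteq> Pow V" using simple by (force simp: simple_graph_def)
  then have finE: "finite E" using finite_V finite_subset by blast
  have "card {(h, h) | h. h \<in> V} = card ((\<lambda>h. (h, h)) ` V)"
    by (rule arg_cong[where f = card]) auto
  also have "\<dots> \<le> card V" using finite_V card_image_le by blast
  finally have 1: "card {(h, h) | h. h \<in> V} \<le> card V" .
  \<comment> \<open>The truth value of \<open>a < b\<close> records the orientation that
    \<open>{a, b}\<close> loses.\<close>
  have "inj_on (\<lambda>(a, b). ({a, b}, a < b)) {(a, b). {a, b} \<in> E}"
    by (auto simp: inj_on_def doubleton_eq_iff)
  then have "card {(a, b). {a, b} \<in> E} \<le> card (E \<times> (UNIV :: bool set))"
    by (rule card_inj_on_le) (use finE in auto)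
  then have 2: "card {(a, b). {a, b} \<in> E} \<le> 2 * card E" by (simp add: card_cartesian_product)
  have "card items \<le> card {(h, h) | h. h \<in> V} + card {(a, b). {a, b} \<in> E}"
    unfolding items_def by (rule card_Un_le)
  then show ?thesis using 1 2 assms by (simp add: algebra_simps)
qed

lemma gdist_item:
  assumes "p \<in> items"
  shows "gdist E (fst p) (snd p) \<le> enat (ilen p)"
proof (cases "fst p = snd p")
  case False
  then have "walk E [fst p, snd p]"
    using assms by (auto simp: items_def walk_def)
  then show ?thesis using False gdist_le_walk[of E "[fst p, snd p]"] by (simp add: ilen_def)
qed (simp add: ilen_def flip: zero_enat_def)

text \<open>The triangle inequality through the item puts both its ends between \<open>u\<close> and
  \<open>v\<close>; this limits the competing items of a small pair to
  \<open>D\<^sup>2\<close>.\<close>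

lemma items_between_subset: "items_between u v \<subseteq> between (u, v) \<times> between (u, v)"
proof
  fix p assume "p \<in> items_between u v"
  then have p: "p \<in> items" and eq: "gdist E u (fst p) + enat (ilen p) + gdist E (snd p) v = gdist E u v"
    by (auto simp: items_between_def)
  note it = gdist_item[OF p]
  have "gdist E (fst p) v \<le> enat (ilen p) + gdist E (snd p) v"
    using gdist_triangle[of E "fst p" v "snd p"] it by (meson add_right_mono order.trans)
  then have "gdist E u (fst p) + gdist E (fst p) v \<le> gdist E u v"
    using eq by (metis add.assoc add_left_mono)
  moreover have "gdist E u (snd p) \<le> gdist E u (fst p) + enat (ilen p)"
    using gdist_triangle[of E u "snd p" "fst p"] it by (meson add_left_mono order.trans)
  then have "gdist E u (snd p) + gdist E (snd p) v \<le> gdist E u v"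
    using eq by (metis add_right_mono)
  moreover have "fst p \<in> V" "snd p \<in> V" using p items_V by auto
  ultimately have "fst p \<in> between (u, v)" "snd p \<in> between (u, v)"
    using gdist_triangle by (auto simp: between_def intro: antisym)
  then show "p \<in> between (u, v) \<times> between (u, v)" by (simp add: mem_Times_iff)
qed

lemma card_items_between:
  assumes "(u, v) \<in> small_pairs D"
  shows "finite (items_between u v)" "card (items_between u v) \<le> D\<^sup>2"
proof -
  show "finite (items_between u v)"
    using finite_items by (simp add: items_between_def)
  have "card (items_between u v) \<le> card (between (u, v) \<times> between (u, v))"
    by (intro card_mono items_between_subset finite_cartesian_product finite_between)
  also have "\<dots> \<le> D\<^sup>2"
    using assms by (auto simp: card_cartesian_product power2_eq_square small_pairs_def intro!: mult_mono)
  finally show "card (items_between u v) \<le> D\<^sup>2" .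
qed

text \<open>The parameter \<open>l\<close> is \<open>0\<close> for the vertex at position
  \<open>i\<close> and \<open>1\<close> for the edge leaving it, so that both kinds are treated at
  once.\<close>

lemma spath_item:
  assumes "(u, v) \<in> dist_pairs" "i + l \<le> len u v" "l \<le> 1"
  shows "(spath u v i, spath u v (i + l)) \<in> items" "ilen (spath u v i, spath u v (i + l)) = l"
proof -
  consider "l = 0" | "l = 1" using assms(3) by linarith
  then have "(spath u v i, spath u v (i + l)) \<in> items \<and> ilen (spath u v i, spath u v (i + l)) = l"
  proof cases
    case 1
    then show ?thesis using spath_V[OF assms(1)] assms(2) by (simp add: items_def ilen_def)
  next
    case 2
    then show ?thesis using spath_edge[OF assms(1), of i] edge_V[of "spath u v i" "spath u v (Suc i)"] assms(2)
      by (auto simp: items_def ilen_def)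
  qed
  then show "(spath u v i, spath u v (i + l)) \<in> items" "ilen (spath u v i, spath u v (i + l)) = l" by auto
qed

lemma ilen_le: "ilen p \<le> 1" by (simp add: ilen_def)

lemma mate_items:
  assumes "(u, v) \<in> dist_pairs" "p \<in> items_between u v"
  shows "mate u v p \<in> items"
proof -
  have "gdist E u (fst p) + enat (ilen p) + gdist E (snd p) v = enat (len u v)"
    using assms by (simp add: items_between_def gdist_len)
  then obtain a b where ab: "gdist E u (fst p) = enat a" "a + ilen p + b = len u v"
    by (cases "gdist E u (fst p)"; cases "gdist E (snd p) v") auto
  then show ?thesis
    using spath_item(1)[OF assms(1) _ ilen_le, of a p] by (simp add: mate_def len_def)
qed

text \<open>Every small pair that is not good yields a conflict: an item that differs from its mate
  but has the same colour. At most \<open>(card V)\<^sup>2 * D\<^sup>2\<close> conflicts are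
  possible, and \<open>ex_colouring_few_monochromatic\<close> leaves at most a fraction
  \<open>1 / q\<close> of them.\<close>

lemma ex_colouring_few_bad:
  assumes "q > 0"
  shows "\<exists>c. (\<forall>p. c p < q) \<and> q * card (small_pairs D - good_pairs D c) \<le> (card V)\<^sup>2 * D\<^sup>2"
proof -
  define T where "T = {((u, v), p). (u, v) \<in> small_pairs D \<and> p \<in> items_between u v \<and> p \<noteq> mate u v p}"
  define f where "f = (\<lambda>(r :: nat \<times> nat, p :: nat \<times> nat). p)"
  define g where "g = (\<lambda>((u, v), p). mate u v p)"
  have fin_small: "finite (small_pairs D)"
    using small_subset finite_dist_pairs finite_subset by blast
  let ?U = "Sigma (small_pairs D) (\<lambda>(u, v). items_between u v)"
  have TU: "T \<subseteq> ?U" by (auto simp: T_def)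
  have finU: "finite ?U" using fin_small card_items_between(1) by auto
  then have finT: "finite T" using TU finite_subset by blast
  have "card T \<le> card ?U" using TU finU card_mono by blast
  also have "\<dots> = (\<Sum>(u, v)\<in>small_pairs D. card (items_between u v))"
    using fin_small card_items_between(1) by (subst card_SigmaI) (auto intro!: sum.cong)
  also have "\<dots> \<le> (\<Sum>r\<in>small_pairs D. D\<^sup>2)"
    using card_items_between(2) by (intro sum_mono) auto
  also have "\<dots> \<le> (card V)\<^sup>2 * D\<^sup>2"
    using card_mono[OF finite_dist_pairs small_subset, of D] card_dist_pairs by simp
  finally have cardT: "card T \<le> (card V)\<^sup>2 * D\<^sup>2" .
  have mem: "f t \<in> items \<and> g t \<in> items" if "t \<in> T" for t
  proof -
    obtain u v p where t: "t = ((u, v), p)" by (metis surj_pair)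
    then have "(u, v) \<in> dist_pairs" "p \<in> items_between u v" using that small_subset by (auto simp: T_def)
    then show ?thesis using mate_items by (auto simp: t f_def g_def items_between_def)
  qed
  have neq: "f t \<noteq> g t" if "t \<in> T" for t using that by (auto simp: T_def f_def g_def)
  obtain c where c: "\<And>x. c x < q"
    "q * card {t \<in> T. f t \<in> items \<and> g t \<in> items \<and> c (f t) = c (g t)}
      \<le> card {t \<in> T. f t \<in> items \<and> g t \<in> items}"
    using ex_colouring_few_monochromatic[OF finite_items finT assms, of f g] neq by blast
  have "small_pairs D - good_pairs D c \<subseteq> fst ` {t \<in> T. c (f t) = c (g t)}"
  proof
    fix r assume r: "r \<in> small_pairs D - good_pairs D c"
    obtain u v where uv: "r = (u, v)" by fastforce
    obtain p where "p \<in> items_between u v" "p \<noteq> mate u v p" "c p = c (mate u v p)"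
      using r by (auto simp: good_pairs_def uv)
    then show "r \<in> fst ` {t \<in> T. c (f t) = c (g t)}"
      using r by (intro image_eqI[of _ _ "(r, p)"]) (auto simp: uv T_def f_def g_def)
  qed
  then have "card (small_pairs D - good_pairs D c) \<le> card {t \<in> T. c (f t) = c (g t)}"
    by (intro surj_card_le) (use finT in auto)
  then have "q * card (small_pairs D - good_pairs D c) \<le> q * card {t \<in> T. c (f t) = c (g t)}" by simp
  also have "\<dots> \<le> card T"
  proof -
    have "{t \<in> T. f t \<in> items \<and> g t \<in> items \<and> c (f t) = c (g t)} = {t \<in> T. c (f t) = c (g t)}"
      "{t \<in> T. f t \<in> items \<and> g t \<in> items} = T" using mem by auto
    then show ?thesis using c(2) by simp
  qed
  finally show ?thesis using cardT c(1) by (intro exI[of _ c]) auto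
qed

section \<open>Maximal matchings of the pairs through an item\<close>

lemma through_subset: "through Q p a b \<subseteq> Q" by (auto simp: through_def)

lemma maxmat:
  assumes "finite R"
  shows maxmat_subset: "maxmat R \<subseteq> R" and maxmat_inj: "inj_on fst (maxmat R)" "inj_on snd (maxmat R)"
    and maxmat_cover: "(u, v) \<in> R \<Longrightarrow> u \<in> fst ` maxmat R \<or> v \<in> snd ` maxmat R"
proof -
  have *: "maxmat R \<subseteq> R \<and> inj_on fst (maxmat R) \<and> inj_on snd (maxmat R) \<and>
      (\<forall>(u, v)\<in>R. u \<in> fst ` maxmat R \<or> v \<in> snd ` maxmat R)"
    unfolding maxmat_def by (rule someI_ex) (rule ex_maximal_matching[OF assms])
  show "maxmat R \<subseteq> R" "inj_on fst (maxmat R)" "inj_on snd (maxmat R)" using * by auto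
  show "(u, v) \<in> R \<Longrightarrow> u \<in> fst ` maxmat R \<or> v \<in> snd ` maxmat R" using * by blast
qed

lemma finite_good: "finite (good_pairs D c)"
  using finite_subset[OF good_subset finite_subset[OF small_subset finite_dist_pairs]] .

lemma finite_through: "finite (through (good_pairs D c) p a b)"
  using finite_subset[OF through_subset finite_good] .

(* If (u, v') is matched for p', both p and p' lie between u and v' at the same position, so
   a good pair forces them to have different colours unless p = p'. *)
lemma induced_family_maxmat:
  "induced_family {p \<in> items. ilen p = l \<and> c p = k} (\<lambda>p. maxmat (through (good_pairs D c) p a b))"
proof (rule induced_familyI)
  let ?M = "\<lambda>p. maxmat (through (good_pairs D c) p a b)"
  fix p x y y' assume "(x, y) \<in> ?M p" "(x, y') \<in> ?M p"
  then show "y = y'" using inj_onD[OF maxmat_inj(1)[OF finite_through[of D c p a b]], of "(x, y)" "(x, y')"] by simp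
next
  let ?M = "\<lambda>p. maxmat (through (good_pairs D c) p a b)"
  fix p x x' y assume "(x, y) \<in> ?M p" "(x', y) \<in> ?M p"
  then show "x = x'" using inj_onD[OF maxmat_inj(2)[OF finite_through[of D c p a b]], of "(x, y)" "(x', y)"] by simp
next
  let ?T = "\<lambda>p. through (good_pairs D c) p a b"
  fix p p' u v u' v'
  assume p: "p \<in> {p \<in> items. ilen p = l \<and> c p = k}" and p': "p' \<in> {p \<in> items. ilen p = l \<and> c p = k}"
    and "(u, v) \<in> maxmat (?T p)" "(u', v') \<in> maxmat (?T p)" "(u, v') \<in> maxmat (?T p')"
  then have T: "(u, v) \<in> ?T p" "(u', v') \<in> ?T p" "(u, v') \<in> ?T p'"
    using maxmat_subset[OF finite_through] by blast+
  then have g: "(u, v) \<in> dist_pairs" "(u', v') \<in> dist_pairs" "(u, v') \<in> dist_pairs"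
    using through_subset good_subset small_subset by blast+
  have l: "ilen p = l" "ilen p' = l" "c p = k" "c p' = k" using p p' by auto
  have 1: "gdist E u (fst p) = enat a"
    using T(1) gdist_spath_left[OF g(1), of a] by (simp add: through_def l)
  have "gdist E (snd p) v' = enat b"
    using T(2) gdist_spath_right[OF g(2), of "a + l"] by (simp add: through_def l)
  moreover have "gdist E u v' = enat (a + l + b)"
    using T(3) gdist_len[OF g(3)] by (simp add: through_def l)
  ultimately have "p \<in> items_between u v'"
    using 1 p by (simp add: items_between_def l)
  moreover have "mate u v' p = p'"
    using T(3) by (simp add: mate_def 1 len_def through_def l prod_eq_iff)
  moreover have "(u, v') \<in> good_pairs D c" using T(3) through_subset by blast
  ultimately show "p = p'" using l by (auto simp: good_pairs_def)
qed

text \<open>The items split into \<open>2 * q\<close> classes by kind and colour. Each class carries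
  an induced family of at most \<open>(1 + 2 * k) * card V\<close> matchings, so
  \<open>induced_family_card_le\<close> applies with \<open>G = 1 + 2 * k\<close>; the constant is
  \<open>18 = 2 * 9\<close>.\<close>

lemma sum_card_maxmat:
  assumes n: "card V \<ge> 2" and k: "card E \<le> k * card V" and q: "\<And>p. c p < q"
  shows "(\<Sum>p\<in>items. real (card (maxmat (through (good_pairs D c) p a b))))
     \<le> 18 * real q * real (1 + 2 * k) * (real (card V))\<^sup>2 / RS (card V)"
proof -
  let ?m = "\<lambda>p. real (card (maxmat (through (good_pairs D c) p a b)))"
  let ?J = "{..<2::nat} \<times> {..<q}"
  have "(\<Sum>p\<in>items. ?m p) = (\<Sum>j\<in>?J. \<Sum>p | p \<in> items \<and> (ilen p, c p) = j. ?m p)"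
    by (rule sum.group[symmetric]) (use finite_items q in \<open>auto simp: ilen_def\<close>)
  also have "\<dots> \<le> (\<Sum>j\<in>?J. 9 * real (1 + 2 * k) * (real (card V))\<^sup>2 / RS (card V))"
  proof (rule sum_mono)
    fix j assume "j \<in> ?J"
    obtain l i where j: "j = (l, i)" by fastforce
    let ?I = "{p \<in> items. ilen p = l \<and> c p = i}"
    have "card ?I \<le> card items" using finite_items by (intro card_mono) auto
    also have "\<dots> \<le> (1 + 2 * k) * card V" by (rule card_items[OF k])
    finally have "card ?I \<le> (1 + 2 * k) * card V" .
    moreover have "maxmat (through (good_pairs D c) p a b) \<subseteq> V \<times> V" for p
    proof -
      have "maxmat (through (good_pairs D c) p a b) \<subseteq> dist_pairs"
        using maxmat_subset[OF finite_through[of D c p a b]] through_subset[of "good_pairs D c" p a b]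
          good_subset[of D c] small_subset[of D] by order
      then show ?thesis by (auto simp: dist_pairs_def)
    qed
    ultimately have "(\<Sum>p\<in>?I. ?m p) \<le> 9 * real (1 + 2 * k) * (real (card V))\<^sup>2 / RS (card V)"
      using induced_family_card_le[OF refl n _ _ induced_family_maxmat, of l c i "1 + 2 * k" D a b] finite_items
      by simp
    then show "(\<Sum>p | p \<in> items \<and> (ilen p, c p) = j. ?m p) \<le> 9 * real (1 + 2 * k) * (real (card V))\<^sup>2 / RS (card V)"
      by (simp add: j)
  qed
  also have "\<dots> = 18 * real q * real (1 + 2 * k) * (real (card V))\<^sup>2 / RS (card V)" by simp
  finally show ?thesis .
qed

section \<open>Hub sets obtained from the matchings\<close>

definition ends :: "(nat \<times> nat) set \<Rightarrow> nat \<times> nat \<Rightarrow> nat \<Rightarrow> nat \<Rightarrow> nat set" where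
  "ends Q p a b = fst ` maxmat (through Q p a b) \<union> snd ` maxmat (through Q p a b)"

text \<open>These are the items assigned to \<open>u\<close>; both ends of each become hubs of
  \<open>u\<close>. Positions below \<open>D\<close> suffice by \<open>len_small\<close>.\<close>

definition cover_items :: "(nat \<times> nat) set \<Rightarrow> nat \<Rightarrow> nat \<Rightarrow> (nat \<times> nat) set" where
  "cover_items Q D u = {p \<in> items. \<exists>a<D. \<exists>b<D. u \<in> ends Q p a b}"

lemma card_ends: "card (ends (good_pairs D c) p a b) \<le> 2 * card (maxmat (through (good_pairs D c) p a b))"
proof -
  let ?M = "maxmat (through (good_pairs D c) p a b)"
  have "finite ?M" using finite_through maxmat_subset finite_subset by metis
  then have "card (fst ` ?M) \<le> card ?M" "card (snd ` ?M) \<le> card ?M" by (auto intro: card_image_le)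
  then show ?thesis using card_Un_le[of "fst ` ?M" "snd ` ?M"] by (simp add: ends_def)
qed

text \<open>Double counting: a matching edge has two ends and there are \<open>D\<^sup>2\<close>
  choices of \<open>a\<close> and \<open>b\<close>, so the bound of \<open>sum_card_maxmat\<close>
  is multiplied by \<open>2 * D\<^sup>2\<close>.\<close>

lemma sum_card_cover_items:
  assumes n: "card V \<ge> 2" and k: "card E \<le> k * card V" and q: "\<And>p. c p < q"
  shows "(\<Sum>u\<in>V. real (card (cover_items (good_pairs D c) D u)))
     \<le> 36 * (real D)\<^sup>2 * real q * real (1 + 2 * k) * (real (card V))\<^sup>2 / RS (card V)"
proof -
  let ?Q = "good_pairs D c"
  let ?X = "items \<times> ({..<D} \<times> {..<D})"
  let ?e = "\<lambda>(p, a, b). ends ?Q p a b"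
  let ?m = "\<lambda>p a b. card (maxmat (through ?Q p a b))"
  let ?B = "18 * real q * real (1 + 2 * k) * (real (card V))\<^sup>2 / RS (card V)"
  have finX: "finite ?X" using finite_items by simp
  have "card (cover_items ?Q D u) \<le> card {x \<in> ?X. u \<in> ?e x}" for u
    by (rule surj_card_le[of _ _ fst]) (use finX in \<open>force simp: cover_items_def\<close>)+
  then have "(\<Sum>u\<in>V. card (cover_items ?Q D u)) \<le> (\<Sum>u\<in>V. card {x \<in> ?X. u \<in> ?e x})"
    by (rule sum_mono)
  also have "\<dots> = (\<Sum>x\<in>?X. card {u \<in> V. u \<in> ?e x})"
    by (rule sum_multicount_gen) (use finX finite_V in auto)
  also have "\<dots> \<le> (\<Sum>(p, a, b)\<in>?X. 2 * ?m p a b)"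
  proof (rule sum_mono)
    fix x assume "x \<in> ?X"
    obtain p a b where x: "x = (p, a, b)" by (metis surj_pair)
    have "finite (maxmat (through ?Q p a b))"
      using finite_through maxmat_subset finite_subset by metis
    then have "card {u \<in> V. u \<in> ends ?Q p a b} \<le> card (ends ?Q p a b)"
      by (intro card_mono) (auto simp: ends_def)
    then show "card {u \<in> V. u \<in> ?e x} \<le> (case x of (p, a, b) \<Rightarrow> 2 * ?m p a b)"
      using card_ends[of D c p a b] by (simp add: x)
  qed
  also have "\<dots> = (\<Sum>(a, b)\<in>{..<D} \<times> {..<D}. \<Sum>p\<in>items. 2 * ?m p a b)"
    by (subst sum.cartesian_product[symmetric], subst sum.swap) (simp add: case_prod_unfold)
  finally have "(\<Sum>u\<in>V. card (cover_items ?Q D u)) \<le> \<dots>" .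
  then have "real (\<Sum>u\<in>V. card (cover_items ?Q D u)) \<le> real (\<Sum>(a, b)\<in>{..<D} \<times> {..<D}. \<Sum>p\<in>items. 2 * ?m p a b)"
    by (simp only: of_nat_le_iff)
  then have "(\<Sum>u\<in>V. real (card (cover_items ?Q D u)))
      \<le> (\<Sum>(a, b)\<in>{..<D} \<times> {..<D}. 2 * (\<Sum>p\<in>items. real (?m p a b)))"
    by (simp add: case_prod_unfold sum_distrib_left)
  also have "\<dots> \<le> (\<Sum>(a, b)\<in>{..<D} \<times> {..<D}. 2 * ?B)"
  proof (rule sum_mono)
    fix x assume "x \<in> {..<D} \<times> {..<D}"
    obtain a b where "x = (a, b)" by fastforce
    then show "(case x of (a, b) \<Rightarrow> 2 * (\<Sum>p\<in>items. real (?m p a b))) \<le> (case x of (a, b) \<Rightarrow> 2 * ?B)"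
      using mult_left_mono[OF sum_card_maxmat[OF n k, of c q D a b, OF q], of 2] by simp
  qed
  also have "\<dots> = 36 * (real D)\<^sup>2 * real q * real (1 + 2 * k) * (real (card V))\<^sup>2 / RS (card V)"
    by (simp add: power2_eq_square)
  finally show ?thesis .
qed

(* Along the alternating sequence of vertices and edges of the path, every item is covered at u
   or at v; at the first one not covered at u, its predecessor is covered at u. *)
lemma good_pair_hub:
  assumes good: "(u, v) \<in> good_pairs D c"
  defines "F \<equiv> cover_items (good_pairs D c) D"
  shows "\<exists>w \<in> (insert u (fst ` F u \<union> snd ` F u)) \<inter> (insert v (fst ` F v \<union> snd ` F v)).
           gdist E u w + gdist E w v = gdist E u v"
proof -
  have small: "(u, v) \<in> small_pairs D" using good good_subset by blast
  then have r: "(u, v) \<in> dist_pairs" using small_subset by blast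
  let ?L = "len u v"
  let ?w = "spath u v"
  \<comment> \<open>\<open>?p k\<close> is a vertex of the path for even \<open>k\<close> and an
    edge for odd \<open>k\<close>; the second end of \<open>?p k\<close> is always the first end of
    \<open>?p (Suc k)\<close>.\<close>
  let ?p = "\<lambda>k. (?w (k div 2), ?w (Suc k div 2))"
  have on_path: "gdist E u (?w i) + gdist E (?w i) v = gdist E u v" if "i \<le> ?L" for i
    using spath_between[OF r that] by (simp add: between_def)
  have cov: "?p k \<in> F u \<or> ?p k \<in> F v" if k: "k \<le> 2 * ?L" for k
  proof -
    \<comment> \<open>\<open>a\<close> and \<open>b\<close> are the distances of the item from
      \<open>u\<close> and \<open>v\<close>, and \<open>l\<close> is its kind.\<close>
    define a l b where "a = k div 2" and "l = k mod 2" and "b = ?L - Suc k div 2"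
    have al: "Suc k div 2 = a + l" unfolding a_def l_def by presburger
    have l1: "l \<le> 1" by (simp add: l_def)
    have alL: "a + l \<le> ?L" using k al[symmetric] by presburger
    note it = spath_item[OF r alL l1]
    have len: "?L = a + l + b" using alL by (simp add: b_def al)
    have "(u, v) \<in> through (good_pairs D c) (?p k) a b"
      using good it(2) len by (simp add: through_def al flip: a_def)
    then have "u \<in> ends (good_pairs D c) (?p k) a b \<or> v \<in> ends (good_pairs D c) (?p k) a b"
      using maxmat_cover[OF finite_through] unfolding ends_def by blast
    moreover have "a < D" "b < D" using len_small[OF small] len by linarith+
    moreover have "?p k \<in> items" using it(1) by (simp add: al flip: a_def)
    ultimately show ?thesis unfolding F_def cover_items_def by blast
  qed
  show ?thesis
  proof (cases "\<forall>k\<le>2 * ?L. ?p k \<in> F u")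
    case True
    \<comment> \<open>The last item is \<open>(v, v)\<close>, so \<open>v\<close> itself is the
      common hub.\<close>
    then have "?p (2 * ?L) \<in> F u" by blast
    then have "v \<in> fst ` F u" using spath_len[OF r] by force
    then show ?thesis by (intro bexI[of _ v]) auto
  next
    case False
    define k where "k = (LEAST k. k \<le> 2 * ?L \<and> ?p k \<notin> F u)"
    have k: "k \<le> 2 * ?L" "?p k \<notin> F u"
      using LeastI_ex[of "\<lambda>k. k \<le> 2 * ?L \<and> ?p k \<notin> F u"] False by (auto simp: k_def)
    have pv: "?p k \<in> F v" using cov k by blast
    show ?thesis
    proof (cases k)
      case 0
      \<comment> \<open>The first item is \<open>(u, u)\<close>, and it is covered at
        \<open>v\<close>.\<close>
      then have "u \<in> fst ` F v" using pv spath_0[OF r] by force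
      then show ?thesis by (intro bexI[of _ u]) auto
    next
      case (Suc j)
      then have "j \<le> 2 * ?L" "j < k" using k by auto
      then have "?p j \<in> F u" using not_less_Least[of j "\<lambda>k. k \<le> 2 * ?L \<and> ?p k \<notin> F u"] by (auto simp: k_def)
      then have "?w (k div 2) \<in> snd ` F u" using Suc by force
      moreover have "?w (k div 2) \<in> fst ` F v" using pv by force
      moreover have "k div 2 \<le> ?L" using k by linarith
      ultimately show ?thesis using on_path by (intro bexI[of _ "?w (k div 2)"]) auto
    qed
  qed
qed

text \<open>The four terms count, in this order: the common hitting set together with the vertex
  itself; pairs with at least \<open>D\<close> vertices between them that the hitting set misses;
  small pairs that are not good; and both ends of the assigned items, whence
  \<open>72 = 2 * 36\<close>.\<close>

lemma ex_hub_labeling: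
  assumes n: "card V \<ge> 2" and k: "card E \<le> k * card V" and q: "q > 0"
  shows "\<exists>S. hub_labeling V E S \<and> (\<Sum>v\<in>V. real (card (S v))) \<le>
    real (card V) * (real t + 1) + (real (card V))\<^sup>2 * exp (- (real D * real t / real (card V)))
    + (real (card V))\<^sup>2 * (real D)\<^sup>2 / real q
    + 72 * (real D)\<^sup>2 * real q * real (1 + 2 * k) * (real (card V))\<^sup>2 / RS (card V)"
proof -
  let ?n = "real (card V)"
  have V: "V \<noteq> {}" using n by auto
  define Q where "Q = {r \<in> dist_pairs. D \<le> card (between r)}"
  have finQ: "finite Q" using finite_dist_pairs by (simp add: Q_def)
  obtain S0 where S0: "S0 \<subseteq> V" "card S0 \<le> t"
    "real (card {r \<in> Q. between r \<inter> S0 = {}}) \<le> real (card Q) * exp (- (real D * real t / ?n))"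
    using ex_hitting_set[OF finite_V V finQ, of between D t] between_subset by (auto simp: Q_def)
  obtain c where c: "\<And>p. c p < q" "q * card (small_pairs D - good_pairs D c) \<le> (card V)\<^sup>2 * D\<^sup>2"
    using ex_colouring_few_bad[OF q] by blast
  define B where "B = {r \<in> Q. between r \<inter> S0 = {}} \<union> (small_pairs D - good_pairs D c)"
  have BD: "B \<subseteq> dist_pairs" using small_subset by (auto simp: B_def Q_def)
  then have BV: "B \<subseteq> V \<times> V" by (auto simp: dist_pairs_def)
  then have finB: "finite B" using finite_V finite_subset by blast
  define F where "F = cover_items (good_pairs D c) D"
  have FV: "F u \<subseteq> V \<times> V" for u using items_V by (auto simp: F_def cover_items_def)
  then have finF: "finite (F u)" for u using finite_V finite_subset by blast
  define S where "S u = S0 \<union> {u} \<union> B `` {u} \<union> (fst ` F u \<union> snd ` F u)" for u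
  have "hub_labeling V E S"
    unfolding hub_labeling_def
  proof (intro conjI ballI impI)
    fix u assume "u \<in> V"
    then show "S u \<subseteq> V" using S0(1) BV FV[of u] by (auto simp: S_def)
  next
    fix u v assume uv: "u \<in> V" "v \<in> V" "gdist E u v \<noteq> \<infinity>"
    then have r: "(u, v) \<in> dist_pairs" by (simp add: dist_pairs_def)
    consider (bad) "(u, v) \<in> B" | (hit) "between (u, v) \<inter> S0 \<noteq> {}" | (good) "(u, v) \<in> good_pairs D c"
      using r by (force simp: B_def Q_def small_pairs_def)
    then show "\<exists>w\<in>S u \<inter> S v. gdist E u w + gdist E w v = gdist E u v"
    proof cases
      case bad
      \<comment> \<open>\<open>v\<close> enters \<open>S u\<close> through \<open>B\<close> and
        \<open>S v\<close> as its own hub, so an exceptional ordered pair costs a single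
        entry.\<close>
      then show ?thesis by (intro bexI[of _ v]) (auto simp: S_def)
    next
      case hit
      then show ?thesis by (auto simp: S_def between_def)
    next
      case good
      from good_pair_hub[OF good] show ?thesis by (auto simp: S_def F_def)
    qed
  qed
  moreover have "(\<Sum>v\<in>V. real (card (S v))) \<le> ?n * (real t + 1) + ?n\<^sup>2 * exp (- (real D * real t / ?n))
    + ?n\<^sup>2 * (real D)\<^sup>2 / real q + 72 * (real D)\<^sup>2 * real q * real (1 + 2 * k) * ?n\<^sup>2 / RS (card V)"
  proof -
    have "card (S u) \<le> t + 1 + card (B `` {u}) + 2 * card (F u)" for u
    proof -
      have "card (fst ` F u) \<le> card (F u)" "card (snd ` F u) \<le> card (F u)"
        using finF by (auto intro: card_image_le)
      then have "card (fst ` F u \<union> snd ` F u) \<le> 2 * card (F u)"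
        using card_Un_le[of "fst ` F u" "snd ` F u"] by linarith
      moreover have "card (S0 \<union> {u}) \<le> t + 1" using card_Un_le[of S0 "{u}"] S0(2) by simp
      moreover have "card (S0 \<union> {u} \<union> B `` {u}) \<le> card (S0 \<union> {u}) + card (B `` {u})" by (rule card_Un_le)
      moreover have "card (S u) \<le> card (S0 \<union> {u} \<union> B `` {u}) + card (fst ` F u \<union> snd ` F u)"
        unfolding S_def by (rule card_Un_le)
      ultimately show ?thesis by linarith
    qed
    then have "(\<Sum>v\<in>V. real (card (S v))) \<le> (\<Sum>u\<in>V. real (t + 1 + card (B `` {u}) + 2 * card (F u)))"
      by (intro sum_mono) (simp only: of_nat_le_iff)
    also have "\<dots> = ?n * (real t + 1) + real (\<Sum>u\<in>V. card (B `` {u})) + 2 * (\<Sum>u\<in>V. real (card (F u)))"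
      by (simp add: sum.distrib sum_distrib_left algebra_simps)
    also have "(\<Sum>u\<in>V. card (B `` {u})) = card B"
    proof -
      have "B = (SIGMA u:V. B `` {u})" using BV by auto
      moreover have "finite (B `` {u})" for u using finB by simp
      ultimately show ?thesis using card_SigmaI[of V "\<lambda>u. B `` {u}"] finite_V by simp
    qed
    also have "real (card B) \<le> ?n\<^sup>2 * exp (- (real D * real t / ?n)) + ?n\<^sup>2 * (real D)\<^sup>2 / real q"
    proof -
      have "card Q \<le> card dist_pairs" using finite_dist_pairs by (intro card_mono) (auto simp: Q_def)
      then have "card Q \<le> (card V)\<^sup>2" using card_dist_pairs by linarith
      then have "real (card Q) \<le> ?n\<^sup>2" by (simp flip: of_nat_power)
      then have "real (card Q) * exp (- (real D * real t / ?n)) \<le> ?n\<^sup>2 * exp (- (real D * real t / ?n))"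
        by (intro mult_right_mono) auto
      moreover have "real q * real (card (small_pairs D - good_pairs D c)) \<le> ?n\<^sup>2 * (real D)\<^sup>2"
        using c(2) by (simp flip: of_nat_mult of_nat_power)
      then have "real (card (small_pairs D - good_pairs D c)) \<le> ?n\<^sup>2 * (real D)\<^sup>2 / real q"
        using q by (simp add: field_simps)
      moreover have "real (card B) \<le> real (card {r \<in> Q. between r \<inter> S0 = {}}) + real (card (small_pairs D - good_pairs D c))"
        unfolding B_def of_nat_add[symmetric] of_nat_le_iff by (rule card_Un_le)
      ultimately show ?thesis using S0(3) by linarith
    qed
    also have "2 * (\<Sum>u\<in>V. real (card (F u))) \<le> 72 * (real D)\<^sup>2 * real q * real (1 + 2 * k) * ?n\<^sup>2 / RS (card V)"
      using mult_left_mono[OF sum_card_cover_items[OF n k, of c q D], of 2] c(1) by (simp add: F_def)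
    finally show ?thesis by (simp add: algebra_simps)
  qed
  ultimately show ?thesis by blast
qed

end

section \<open>Choice of parameters\<close>

lemma nat_ceiling_le_twice:
  fixes x :: real
  assumes "x \<ge> 1"
  shows "real (nat \<lceil>x\<rceil>) \<le> 2 * x" "x \<le> real (nat \<lceil>x\<rceil>)" "nat \<lceil>x\<rceil> > 0"
  using assms by linarith+

(* With R = y^28, the parameters D = y^5, q = y^14 and t = n / y^4 make every term O(n^2 / y^4). *)
theorem theorem2:
  shows "\<exists>c::real. 0 < c \<and> c \<le> 7 \<and>
    (\<forall>K::real. K > 0 \<longrightarrow> (\<exists>C_K::real. \<forall>(V::nat set) (E::nat set set).
       simple_graph V E \<and> card V \<ge> 2 \<and> real (card E) \<le> K * real (card V) \<longrightarrow>
       (\<exists>S. hub_labeling V E S \<and>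
          (1 / real (card V)) * (\<Sum>v\<in>V. real (card (S v)))
            \<le> C_K * real (card V) / (RS (card V)) powr (1 / c))))"
proof (rule exI[of _ "7::real"], intro conjI allI impI)
  fix K :: real assume "K > 0"
  define k where "k = nat \<lceil>K\<rceil>"
  \<comment> \<open>\<open>263 = 3 + 256 + 4\<close> collects the first three terms of
    \<open>ex_hub_labeling\<close>; in the last one, \<open>576 = 72 * 4 * 2\<close> includes the
    rounding losses in \<open>(real D)\<^sup>2\<close> and \<open>q\<close>.\<close>
  define C where "C = 263 + 576 * real (1 + 2 * k)"
  have C1: "C \<ge> 1" by (simp add: C_def)
  show "\<exists>C_K::real. \<forall>(V::nat set) (E::nat set set).
       simple_graph V E \<and> card V \<ge> 2 \<and> real (card E) \<le> K * real (card V) \<longrightarrow>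
       (\<exists>S. hub_labeling V E S \<and>
          (1 / real (card V)) * (\<Sum>v\<in>V. real (card (S v)))
            \<le> C_K * real (card V) / (RS (card V)) powr (1 / 7))"
  proof (intro exI[of _ C] allI impI, elim conjE)
    fix V :: "nat set" and E :: "nat set set"
    assume G: "simple_graph V E" and n2: "card V \<ge> 2" and EK: "real (card E) \<le> K * real (card V)"
    define n where "n = real (card V)"
    define R where "R = RS (card V)"
    have n: "n \<ge> 2" using n2 by (simp add: n_def)
    have R0: "R > 0" and Rn: "R \<le> n\<^sup>2" using RS_pos[OF n2] RS_le_square[OF n2] by (simp_all add: R_def n_def)
    define y where "y = R powr (1 / 28)"
    have y0: "y > 0" using R0 by (simp add: y_def)
    have yR: "y ^ 28 = R" using R0 by (simp add: y_def powr_powr flip: powr_realpow)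
    have y4: "y ^ 4 = R powr (1 / 7)" using R0 by (simp add: y_def powr_powr flip: powr_realpow)
    interpret finite_simple_graph V E using G by unfold_locales
    have "K \<le> real k" using \<open>K > 0\<close> unfolding k_def by linarith
    then have "real (card E) \<le> real k * real (card V)"
      using EK by (meson mult_right_mono of_nat_0_le_iff order.trans)
    then have Ek: "card E \<le> k * card V" by (simp flip: of_nat_mult)
    have "\<exists>S. hub_labeling V E S \<and> (\<Sum>v\<in>V. real (card (S v))) \<le> C * n\<^sup>2 / y ^ 4"
    proof (cases "y \<ge> 1")
      \<comment> \<open>For \<open>y < 1\<close> the target is at least \<open>n\<^sup>2\<close>, so
        using all of \<open>V\<close> as hubs is good enough.\<close>
      case False
      have "hub_labeling V E (\<lambda>_. V)"
        unfolding hub_labeling_def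
      proof (intro conjI ballI impI)
        fix u v assume "u \<in> V" "v \<in> V"
        then show "\<exists>w\<in>V \<inter> V. gdist E u w + gdist E w v = gdist E u v" by (intro bexI[of _ v]) auto
      qed simp
      moreover have "y ^ 4 \<le> 1" using False y0 by (simp add: power_le_one)
      then have "n\<^sup>2 * y ^ 4 \<le> n\<^sup>2 * C" using C1 by (intro mult_left_mono) auto
      then have "n\<^sup>2 \<le> C * n\<^sup>2 / y ^ 4" using y0 by (simp add: field_simps)
      ultimately show ?thesis by (intro exI[of _ "\<lambda>_. V"]) (simp add: n_def power2_eq_square)
    next
      case y1: True
      have power_quotient: "y ^ i / y ^ (i + j) = 1 / y ^ j" for i j
        using y0 by (simp add: power_add)
      \<comment> \<open>Otherwise \<open>R = y ^ 28 > n ^ 7\<close>, against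
        \<open>R \<le> n\<^sup>2\<close>. The bound ensures \<open>n / y ^ 4 \<ge> 1\<close>, so
        rounding up to \<open>t\<close> at most doubles the value.\<close>
      have y4n: "y ^ 4 \<le> n"
      proof (rule ccontr)
        assume "\<not> y ^ 4 \<le> n"
        then have "n ^ 7 < (y ^ 4) ^ 7" using n by (intro power_strict_mono) auto
        also have "(y ^ 4) ^ 7 = R" by (simp add: yR flip: power_mult)
        finally have "n ^ 7 < n ^ 2" using Rn by simp
        moreover have "n ^ 2 \<le> n ^ 7" using n by (intro power_increasing) auto
        ultimately show False by simp
      qed
      define D q t where "D = nat \<lceil>y ^ 5\<rceil>" and "q = nat \<lceil>y ^ 14\<rceil>" and "t = nat \<lceil>n / y ^ 4\<rceil>"
      have pos: "y ^ j > 0" "y ^ j \<ge> 1" for j using y0 y1 by auto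
      have D: "real D \<le> 2 * y ^ 5" "y ^ 5 \<le> real D"
        and q: "real q \<le> 2 * y ^ 14" "y ^ 14 \<le> real q" "q > 0"
        unfolding D_def q_def using nat_ceiling_le_twice pos by blast+
      have ny1: "n / y ^ 4 \<ge> 1" using y4n pos(1)[of 4] by simp
      then have t: "real t \<le> 2 * (n / y ^ 4)" "n / y ^ 4 \<le> real t"
        unfolding t_def using nat_ceiling_le_twice by blast+
      have D2: "(real D)\<^sup>2 \<le> 4 * y ^ 10"
      proof -
        have "(real D)\<^sup>2 \<le> (2 * y ^ 5)\<^sup>2" using D by (intro power_mono) auto
        then show ?thesis by (simp add: power_mult_distrib flip: power_mult)
      qed
      obtain S where S: "hub_labeling V E S" "(\<Sum>v\<in>V. real (card (S v))) \<le>
          n * (real t + 1) + n\<^sup>2 * exp (- (real D * real t / n)) + n\<^sup>2 * (real D)\<^sup>2 / real q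
          + 72 * (real D)\<^sup>2 * real q * real (1 + 2 * k) * n\<^sup>2 / R"
        using ex_hub_labeling[OF n2 Ek q(3), of t D] unfolding n_def R_def by blast
      let ?B = "n\<^sup>2 / y ^ 4"
      have 1: "n * (real t + 1) \<le> 3 * ?B"
      proof -
        have "n * (real t + 1) \<le> n * (3 * (n / y ^ 4))"
          using t ny1 n by (intro mult_left_mono) auto
        then show ?thesis by (simp add: power2_eq_square mult_ac)
      qed
      have 2: "n\<^sup>2 * exp (- (real D * real t / n)) \<le> 256 * ?B"
      proof -
        \<comment> \<open>The choice of \<open>D\<close> and \<open>t\<close> makes the exponent
          \<open>D * t / n\<close> at least \<open>y\<close>.\<close>
        have "y ^ 5 = y * y ^ 4" using power_Suc[of y 4] by simp
        then have "y * n = y ^ 5 * (n / y ^ 4)" using y0 by simp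
        also have "\<dots> \<le> real D * real t" using D t pos n by (intro mult_mono) auto
        finally have yle: "y \<le> real D * real t / n" using n by (simp add: field_simps)
        \<comment> \<open>\<open>exp y\<close> dominates \<open>(y / 4) ^ 4\<close>, which gives the
          constant \<open>256 = 4 ^ 4\<close>.\<close>
        have "(y / 4) ^ 4 \<le> (1 + y / 4) ^ 4" using y0 by (intro power_mono) auto
        also have "\<dots> \<le> exp y" using exp_ge_one_plus_x_over_n_power_n[of 4 y] y0 by simp
        finally have "y ^ 4 \<le> 256 * exp y" by (simp add: power_divide)
        then have "exp (- y) \<le> 256 / y ^ 4" using pos(1)[of 4] by (simp add: exp_minus field_simps)
        then have "exp (- (real D * real t / n)) \<le> 256 / y ^ 4" using yle by (smt (verit) exp_le_cancel_iff)
        then have "n\<^sup>2 * exp (- (real D * real t / n)) \<le> n\<^sup>2 * (256 / y ^ 4)"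
          by (intro mult_left_mono) auto
        then show ?thesis by (simp add: mult_ac)
      qed
      have 3: "n\<^sup>2 * (real D)\<^sup>2 / real q \<le> 4 * ?B"
      proof -
        have "n\<^sup>2 * (real D)\<^sup>2 / real q \<le> n\<^sup>2 * (4 * y ^ 10) / y ^ 14"
          using D2 q pos[of 14] by (intro frac_le mult_left_mono) auto
        also have "\<dots> = 4 * ?B"
        proof -
          have "n\<^sup>2 * (4 * y ^ 10) / y ^ 14 = 4 * n\<^sup>2 * (y ^ 10 / y ^ 14)" by simp
          also have "y ^ 10 / y ^ 14 = 1 / y ^ 4" using power_quotient[of 10 4] by simp
          finally show ?thesis by simp
        qed
        finally show ?thesis .
      qed
      have 4: "72 * (real D)\<^sup>2 * real q * real (1 + 2 * k) * n\<^sup>2 / R \<le> 576 * real (1 + 2 * k) * ?B"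
      proof -
        \<comment> \<open>The exponents \<open>10 + 14 = 24\<close> fall short of \<open>28\<close>
          by \<open>4\<close>, the same saving as in the other terms.\<close>
        have "(real D)\<^sup>2 * real q \<le> 4 * y ^ 10 * (2 * y ^ 14)"
          using D2 q pos by (intro mult_mono) auto
        also have "\<dots> = 8 * y ^ 24" by (simp flip: power_add)
        finally have "(real D)\<^sup>2 * real q * (72 * real (1 + 2 * k) * n\<^sup>2 / R)
            \<le> 8 * y ^ 24 * (72 * real (1 + 2 * k) * n\<^sup>2 / R)"
          using R0 by (intro mult_right_mono) auto
        also have "\<dots> = 576 * real (1 + 2 * k) * (n\<^sup>2 * (y ^ 24 / R))" by simp
        also have "y ^ 24 / R = 1 / y ^ 4"
          using power_quotient[of 24 4] by (simp add: yR)
        finally show ?thesis by (simp add: mult_ac)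
      qed
      have "(\<Sum>v\<in>V. real (card (S v))) \<le> C * ?B"
        using S(2) 1 2 3 4 unfolding C_def distrib_right by linarith
      then show ?thesis using S(1) by auto
    qed
    then obtain S where S: "hub_labeling V E S" "(\<Sum>v\<in>V. real (card (S v))) \<le> C * n\<^sup>2 / y ^ 4" by blast
    have "(1 / n) * (\<Sum>v\<in>V. real (card (S v))) \<le> (1 / n) * (C * n\<^sup>2 / y ^ 4)"
      using S(2) n by (intro mult_left_mono) auto
    also have "\<dots> = C * n / R powr (1 / 7)" using n by (simp add: power2_eq_square flip: y4)
    finally show "\<exists>S. hub_labeling V E S \<and>
          (1 / real (card V)) * (\<Sum>v\<in>V. real (card (S v))) \<le> C * real (card V) / (RS (card V)) powr (1 / 7)"
      using S(1) unfolding n_def R_def by blast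
  qed
qed simp_all

end
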